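(* Let $\mathcal L$ be a finite distributive lattice with poset of join-irreducible elements $(P,<)$. The cone $\psi(C(I^h,I^m))$ is a maximal cone in the secondary fan of the order polytope $O(P,<)$.
   Context: $(\mathcal L,\vee,\wedge)$ is a finite distributive lattice with induced order $<$. $P$ is the set of join-irreducible elements of $\mathcal L$ (non-minimal $a$ such that $a=b\vee c$ implies $a=b$ or $a=c$), with the induced order $<$. The map $\iota:a\mapsto\{p\in P: p\le a\}$ is a lattice isomorphism from $\mathcal L$ to the lattice of order ideals (lower sets) of $(P,<)$ (Birkhoff). Put $v_a=\mathbf 1_{\iota(a)}\in\mathbb R^P$. The order polytope $O(P,<)\subset\mathbb R^P$ consists of $x$ with $0\le x_p\le 1$ for all $p$ and $x_p\le x_q$ whenever $p>q$; its vertex set is $V=\{v_a:a\in\mathcal L\}$. $\psi:\mathbb R^{\mathcal L}\to\mathbb R^V$ is the linear isomorphism with $\psi(w)_{v_a}=w_a$. $R=\mathbb C[\{X_a,a\in\mathcal L\}]$. For $w\in\mathbb R^{\mathcal L}$ define an $\mathbb R$-grading on $R$ by giving $X_a$ grading $w_a$; for nonzero $p\in R$, $\mathrm{in}_w p$ is the nonzero homogeneous component of $p$ of least grading, and $\mathrm{in}_w I$ is the linear span of $\{\mathrm{in}_w p: p\in I\}$. $C(I,J)=\{w\in\mathbb R^{\mathcal L}:\mathrm{in}_w I=J\}$. The Hibi ideal $I^h\subset R$ is generated by all $X_aX_b-X_{a\vee b}X_{a\wedge b}$; $I^m\subset R$ is generated by all $X_aX_b$ with $a,b$ incomparable. For an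 $n$-dimensional convex polytope $Q\subset \mathbb R^n$ with vertex set $V$ and $c\in\mathbb R^V$, let $T\subset\mathbb R^n\times\mathbb R$ be the convex hull of the union of the rays $\{v\}\times\{x\le c_v\}$, $v\in V$. The projections to $\mathbb R^n$ of the bounded facets of $T$ form a polyhedral subdivision $\Theta_Q(c)$ of $Q$; such subdivisions are called regular. For a regular subdivision $\Theta$ let $C(\Theta)=\{c\in\mathbb R^V:\Theta_Q(c)=\Theta\}$. The sets $C(\Theta)$ are relatively open polyhedral cones that together form a polyhedral fan with support $\mathbb R^V$, the secondary fan of $Q$; the maximal cones are the full-dimensional ones. *)

theory Defs
  imports "HOL-Analysis.Analysis" "HOL-Analysis.Finite_Function_Topology"
begin

section \<open>Regular subdivisions and the secondary fan of a polytope\<close>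

definition vertices :: "'v::euclidean_space set \<Rightarrow> 'v set" where
  "vertices Q = {v. v extreme_point_of Q}"

text \<open>For a finite set \<open>V\<close>, the space \<open>\<real>\<^sup>V\<close> is the space of finitely supported real functions
  vanishing outside \<open>V\<close>, with the real vector space structure of the library.\<close>

definition coord_space :: "'v set \<Rightarrow> ('v \<Rightarrow>\<^sub>0 real) set" where
  "coord_space V = {c. Poly_Mapping.keys c \<subseteq> V}"

definition hypograph_hull :: "'v::euclidean_space set \<Rightarrow> ('v \<Rightarrow>\<^sub>0 real) \<Rightarrow> ('v \<times> real) set" where
  "hypograph_hull Q c = convex hull (\<Union>v\<in>vertices Q. {v} \<times> {..Poly_Mapping.lookup c v})"

text \<open>The library notion \<open>facet_of\<close> refers to the affine dimension of the set itself, so \<open>Q\<close> need not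
  be full-dimensional in the ambient type. A subdivision is given by its set of maximal cells.\<close>

definition regular_subdivision :: "'v::euclidean_space set \<Rightarrow> ('v \<Rightarrow>\<^sub>0 real) \<Rightarrow> 'v set set" where
  "regular_subdivision Q c = {fst ` F | F. F facet_of hypograph_hull Q c \<and> bounded F}"

definition secondary_cone :: "'v::euclidean_space set \<Rightarrow> 'v set set \<Rightarrow> ('v \<Rightarrow>\<^sub>0 real) set" where
  "secondary_cone Q \<Theta> = {c \<in> coord_space (vertices Q). regular_subdivision Q c = \<Theta>}"

definition secondary_fan :: "'v::euclidean_space set \<Rightarrow> ('v \<Rightarrow>\<^sub>0 real) set set" where
  "secondary_fan Q =
    {secondary_cone Q (regular_subdivision Q c) | c. c \<in> coord_space (vertices Q)}"

text \<open>The maximal cones of the secondary fan are the full-dimensional ones, i.e. those which span a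
  space of the dimension of \<open>\<real>\<^sup>V\<close>.\<close>

definition maximal_secondary_cone :: "'v::euclidean_space set \<Rightarrow> ('v \<Rightarrow>\<^sub>0 real) set \<Rightarrow> bool" where
  "maximal_secondary_cone Q C \<longleftrightarrow> C \<in> secondary_fan Q \<and> dim C = card (vertices Q)"


section \<open>Initial ideals\<close>

text \<open>\<open>\<complex>[X\<^sub>a, a \<in> L]\<close>: finitely supported maps from exponent vectors to coefficients, with the
  convolution product.\<close>

type_synonym 'a poly_ring = "('a \<Rightarrow>\<^sub>0 nat) \<Rightarrow>\<^sub>0 complex"

definition indet :: "'a \<Rightarrow> 'a poly_ring" where
  "indet a = Poly_Mapping.single (Poly_Mapping.single a 1) 1"

definition ideal_gen :: "'a poly_ring set \<Rightarrow> 'a poly_ring set" where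
  "ideal_gen S = module.span (*) S"

definition complex_span :: "'a poly_ring set \<Rightarrow> 'a poly_ring set" where
  "complex_span S = module.span (\<lambda>z p. Poly_Mapping.single 0 z * p) S"

definition grading :: "real ^ 'a \<Rightarrow> ('a::finite \<Rightarrow>\<^sub>0 nat) \<Rightarrow> real" where
  "grading w m = (\<Sum>a\<in>UNIV. real (Poly_Mapping.lookup m a) * w $ a)"

definition homogeneous_component :: "real ^ 'a \<Rightarrow> real \<Rightarrow> 'a::finite poly_ring \<Rightarrow> 'a poly_ring" where
  "homogeneous_component w d p =
    (\<Sum>m\<in>{m \<in> Poly_Mapping.keys p. grading w m = d}. Poly_Mapping.single m (Poly_Mapping.lookup p m))"

text \<open>Only meaningful for \<open>p \<noteq> 0\<close>.\<close>

definition initial_form :: "real ^ 'a \<Rightarrow> 'a::finite poly_ring \<Rightarrow> 'a poly_ring" where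
  "initial_form w p = homogeneous_component w (Min (grading w ` Poly_Mapping.keys p)) p"

definition initial_ideal :: "real ^ 'a \<Rightarrow> 'a::finite poly_ring set \<Rightarrow> 'a poly_ring set" where
  "initial_ideal w I = complex_span {initial_form w p | p. p \<in> I \<and> p \<noteq> 0}"

definition initial_cone :: "'a::finite poly_ring set \<Rightarrow> 'a poly_ring set \<Rightarrow> (real ^ 'a) set" where
  "initial_cone I J = {w. initial_ideal w I = J}"


section \<open>Hibi ideals and order polytopes of finite distributive lattices\<close>

definition hibi_ideal :: "'a::{finite, distrib_lattice} poly_ring set" where
  "hibi_ideal = ideal_gen {indet a * indet b - indet (sup a b) * indet (inf a b) | a b. True}"

definition incomparable_ideal :: "'a::{finite, distrib_lattice} poly_ring set" where
  "incomparable_ideal = ideal_gen {indet a * indet b | a b. \<not> a \<le> b \<and> \<not> b \<le> a}"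

definition join_irreducible :: "'a::{finite, distrib_lattice} \<Rightarrow> bool" where
  "join_irreducible a \<longleftrightarrow> (\<exists>b. b < a) \<and> (\<forall>b c. a = sup b c \<longrightarrow> a = b \<or> a = c)"

text \<open>\<open>\<real>\<^sup>P\<close> is realized as the coordinate subspace of \<open>\<real>\<^sup>L\<close> on which all coordinates outside \<open>P\<close>
  vanish. (\<open>P\<close> is empty for the one-element lattice, so it cannot be made a type.)\<close>

definition order_polytope :: "(real ^ 'a::{finite, distrib_lattice}) set" where
  "order_polytope = {x.
     (\<forall>p. \<not> join_irreducible p \<longrightarrow> x $ p = 0) \<and>
     (\<forall>p. join_irreducible p \<longrightarrow> 0 \<le> x $ p \<and> x $ p \<le> 1) \<and>
     (\<forall>p q. join_irreducible p \<and> join_irreducible q \<and> p > q \<longrightarrow> x $ p \<le> x $ q)}"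

definition birkhoff :: "'a::{finite, distrib_lattice} \<Rightarrow> 'a set" where
  "birkhoff a = {p. join_irreducible p \<and> p \<le> a}"

definition ideal_vertex :: "'a::{finite, distrib_lattice} \<Rightarrow> (real, 'a) vec" where
  "ideal_vertex a = (\<chi> p. indicator (birkhoff a) p)"

text \<open>The linear map with \<open>psi w\<close> taking the value \<open>w $ a\<close> at \<open>ideal_vertex a\<close>;
  see \<open>lookup_psi\<close> below.\<close>

definition psi :: "(real, 'a::{finite, distrib_lattice}) vec \<Rightarrow> ((real, 'a) vec \<Rightarrow>\<^sub>0 real)" where
  "psi w = (\<Sum>a\<in>UNIV. Poly_Mapping.single (ideal_vertex a) (w $ a))"

lemma le_if_birkhoff_subset:
  fixes a b :: "'a::{finite, distrib_lattice}"
  assumes "birkhoff a \<subseteq> birkhoff b"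
  shows "a \<le> b"
proof -
  have "trans {(x, y :: 'a). x < y}"
    by (auto intro: transI)
  then have "wf {(x, y :: 'a). x < y}"
    by (intro finite_acyclic_wf) (auto simp: acyclic_def trancl_id)
  then show ?thesis
    using assms
  proof (induction a rule: wf_induct_rule)
    case (less a)
    show ?case
    proof (cases "join_irreducible a")
      case True
      then show ?thesis using less.prems by (auto simp: birkhoff_def)
    next
      case False
      then consider "\<forall>c. \<not> c < a" | c d where "a = sup c d" "a \<noteq> c" "a \<noteq> d"
        unfolding join_irreducible_def by blast
      then show ?thesis
      proof cases
        case 1
        then have "inf a b = a" by (metis inf_le1 le_neq_trans)
        then show ?thesis by (simp add: le_iff_inf)
      next
        case 2
        then have lt: "c < a" "d < a" by (simp_all add: less_le)
        then have "birkhoff c \<subseteq> birkhoff b" "birkhoff d \<subseteq> birkhoff b"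
          using less.prems by (auto simp: birkhoff_def)
        then show ?thesis using less.IH lt 2 by auto
      qed
    qed
  qed
qed

lemma inj_ideal_vertex: "inj (ideal_vertex :: 'a::{finite, distrib_lattice} \<Rightarrow> _)"
proof (rule injI)
  fix a b :: 'a
  assume "ideal_vertex a = ideal_vertex b"
  then have "indicator (birkhoff a) p = (indicator (birkhoff b) p :: real)" for p
    unfolding ideal_vertex_def by (metis vec_lambda_beta)
  then have "birkhoff a = birkhoff b"
    by (metis (no_types) indicator_eq_1_iff subsetI subset_antisym)
  then show "a = b"
    by (simp add: le_if_birkhoff_subset order.antisym)
qed

lemma lookup_psi: "Poly_Mapping.lookup (psi w) (ideal_vertex a) = w $ a"
  unfolding psi_def
  by (simp add: lookup_sum lookup_single when_def inj_eq[OF inj_ideal_vertex])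

end

theory Submission
  imports Defs
begin

text \<open>
  Both cones turn out to be the cone of strictly supermodular \<open>w\<close>, those with
  \<open>w\<^sub>a + w\<^sub>b < w\<^sub>a\<^sub>\<or>\<^sub>b + w\<^sub>a\<^sub>\<and>\<^sub>b\<close> for incomparable \<open>a, b\<close>. For such \<open>w\<close> and a maximal chain \<open>C\<close>, the
  affine function \<open>g\<close> that interpolates \<open>w\<close> at the vertices \<open>v\<^sub>c\<close>, \<open>c \<in> C\<close>, satisfies
  \<open>g(v\<^sub>a) > w\<^sub>a\<close> for all \<open>a \<notin> C\<close>. Geometrically, the graph of \<open>g\<close> cuts out a bounded facet of the
  hypograph lying over the simplex of \<open>C\<close>; these simplices cover the order polytope, so there are no
  other bounded facets. Algebraically, among all monomials with the same image in the
  Hibi ring the one supported on a chain has strictly the largest grading, so it never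
  occurs in an initial form. Conversely, a failure of strict supermodularity at \<open>a, b\<close> puts a chain
  monomial into the support of an initial form and puts \<open>v\<^sub>a, v\<^sub>b\<close> into a common cell.
\<close>

section \<open>Faces of hypographs over a polytope\<close>

lemma face_of_convex_hull_eq_hull_Int:
  assumes "F face_of convex hull S"
  shows "F = convex hull (F \<inter> S)"
proof
  have "convex F" "F \<subseteq> convex hull S"
    using assms by (auto simp: face_of_def)
  then show "convex hull (F \<inter> S) \<subseteq> F"
    by (simp add: hull_minimal)
  let ?H = "{x \<in> convex hull S. x \<in> F \<longrightarrow> x \<in> convex hull (F \<inter> S)}"
  have "closed_segment x y \<subseteq> ?H" if "x \<in> ?H" "y \<in> ?H" for x y
  proof
    fix z assume z: "z \<in> closed_segment x y"
    then have "z \<in> convex hull S"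
      using that convex_contains_segment convex_convex_hull by blast
    moreover have "z \<in> convex hull (F \<inter> S)" if "z \<in> F" "z \<noteq> x" "z \<noteq> y"
    proof -
      have "x \<in> F" "y \<in> F"
        using face_ofD[OF assms] z that \<open>x \<in> ?H\<close> \<open>y \<in> ?H\<close> by (auto simp: open_segment_def)
      then show ?thesis
        using z \<open>x \<in> ?H\<close> \<open>y \<in> ?H\<close> convex_contains_segment[of "convex hull (F \<inter> S)"] by auto
    qed
    ultimately show "z \<in> ?H"
      using that by blast
  qed
  then have "convex ?H"
    by (simp add: convex_contains_segment)
  then have "convex hull S \<subseteq> ?H"
    by (intro hull_minimal) (auto intro: hull_inc)
  then show "F \<subseteq> convex hull (F \<inter> S)"
    using \<open>F \<subseteq> convex hull S\<close> by blast
qed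

lemma facet_of_eq:
  fixes F G :: "'v::euclidean_space set"
  assumes F: "F facet_of S" and G: "G facet_of S" and meet: "F \<inter> rel_interior G \<noteq> {}"
  shows "F = G"
proof -
  have faces: "F face_of S" "G face_of S"
    using F G by (simp_all add: facet_of_imp_face_of)
  then have "G \<subseteq> F"
    by (meson face_of_imp_subset subset_of_face_of[OF _ _ meet])
  then have "G face_of F"
    using faces face_of_face by blast
  moreover have "aff_dim G = aff_dim F"
    using F G by (simp add: facet_of_def)
  ultimately show ?thesis
    using face_of_aff_dim_lt face_of_imp_convex[OF faces(1)] by fastforce
qed

lemma affine_independent_interpolation:
  fixes S :: "'v::euclidean_space set"
  assumes "\<not> affine_dependent S"
  obtains z b where "\<And>x. x \<in> S \<Longrightarrow> f x = z \<bullet> x + b"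
proof (cases "S = {}")
  case False
  then obtain x0 where x0: "x0 \<in> S" by blast
  then have "independent ((\<lambda>x. - x0 + x) ` (S - {x0}))"
    using assms affine_dependent_iff_dependent2 by blast
  from linear_independent_extend[OF this, of "\<lambda>y. f (x0 + y) - f x0"]
  obtain g where "linear g" and g: "\<And>x. x \<in> S - {x0} \<Longrightarrow> g (- x0 + x) = f x - f x0"
    by auto
  have "f x = adjoint g 1 \<bullet> x + (f x0 - adjoint g 1 \<bullet> x0)" if "x \<in> S" for x
  proof -
    have "adjoint g 1 \<bullet> x - adjoint g 1 \<bullet> x0 = g (- x0 + x)"
      using adjoint_works[OF \<open>linear g\<close>, of "- x0 + x" 1]
      by (simp add: inner_commute inner_diff_left inner_diff_right inner_add_left)
    also have "\<dots> = f x - f x0"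
      using g[of x] that linear_0[OF \<open>linear g\<close>] by (cases "x = x0") auto
    finally show ?thesis by simp
  qed
  then show thesis by (rule that)
qed (use that in blast)

lemma aff_dim_graph:
  fixes S :: "'v::euclidean_space set"
  shows "aff_dim ((\<lambda>x. (x, z \<bullet> x + b)) ` S) = aff_dim S"
proof -
  have "linear (\<lambda>x. (x, z \<bullet> x))"
    by (intro linearI) (simp_all add: inner_add_right)
  moreover have "inj (\<lambda>x. (x, z \<bullet> x))"
    by (simp add: inj_def)
  moreover have "(\<lambda>x. (x, z \<bullet> x + b)) ` S = (+) (0, b) ` (\<lambda>x. (x, z \<bullet> x)) ` S"
    by (simp add: image_image add.commute)
  ultimately show ?thesis
    by (simp only: aff_dim_translation_eq aff_dim_injective_linear_image)
qed

definition lift :: "('v \<Rightarrow>\<^sub>0 real) \<Rightarrow> 'v \<Rightarrow> 'v \<times> real" where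
  "lift c v = (v, Poly_Mapping.lookup c v)"

definition lower_rays :: "'v::euclidean_space set \<Rightarrow> ('v \<Rightarrow>\<^sub>0 real) \<Rightarrow> ('v \<times> real) set" where
  "lower_rays Q c = (\<Union>v\<in>vertices Q. {v} \<times> {..Poly_Mapping.lookup c v})"

lemma hypograph_hull_eq: "hypograph_hull Q c = convex hull lower_rays Q c"
  by (simp add: hypograph_hull_def lower_rays_def)

lemma lower_raysD: "(v, s) \<in> lower_rays Q c \<Longrightarrow> v \<in> vertices Q \<and> s \<le> Poly_Mapping.lookup c v"
  by (auto simp: lower_rays_def)

lemma convex_hypograph_hull: "convex (hypograph_hull Q c)"
  by (simp add: hypograph_hull_def)

lemma vertex_in_hypograph_hull:
  "v \<in> vertices Q \<Longrightarrow> s \<le> Poly_Mapping.lookup c v \<Longrightarrow> (v, s) \<in> hypograph_hull Q c"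
  unfolding hypograph_hull_def by (rule hull_inc) simp

lemma lift_in_hypograph_hull: "v \<in> vertices Q \<Longrightarrow> lift c v \<in> hypograph_hull Q c"
  by (simp add: lift_def vertex_in_hypograph_hull)

lemma fst_hypograph_hull: "fst ` hypograph_hull Q c = convex hull vertices Q"
proof -
  have "fst ` lower_rays Q c = vertices Q"
    by (force simp: lower_rays_def)
  then show ?thesis
    by (simp add: hypograph_hull_eq convex_hull_linear_image linear_fst)
qed

lemma fst_hull_lift: "fst ` (convex hull (lift c ` K)) = convex hull K"
  by (simp add: convex_hull_linear_image linear_fst image_image lift_def)

lemma hypograph_hull_downward:
  assumes "(x, t) \<in> hypograph_hull Q c" "s \<le> t"
  shows "(x, s) \<in> hypograph_hull Q c"
proof -
  have "(+) (0, s - t) ` lower_rays Q c \<subseteq> lower_rays Q c"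
    using assms(2) by (force simp: lower_rays_def)
  then have "(+) (0, s - t) ` hypograph_hull Q c \<subseteq> hypograph_hull Q c"
    unfolding hypograph_hull_eq by (metis convex_hull_translation hull_mono)
  then have "(0, s - t) + (x, t) \<in> hypograph_hull Q c"
    using assms(1) by blast
  then show ?thesis by simp
qed

lemma bounded_face_hypograph_hull_top:
  assumes F: "F face_of hypograph_hull Q c" and "bounded F"
    and xt: "(x, t) \<in> F" and xt': "(x, t') \<in> hypograph_hull Q c"
  shows "t' \<le> t"
proof (rule ccontr)
  assume "\<not> t' \<le> t"
  have "(x, s) \<in> F" if "s < t" for s
  proof -
    have "(x, s) \<in> hypograph_hull Q c"
      using face_of_imp_subset[OF F] xt that by (meson hypograph_hull_downward less_imp_le subsetD)
    moreover have "t \<in> open_segment s t'"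
      using that \<open>\<not> t' \<le> t\<close> by (simp add: open_segment_eq_real_ivl)
    then have "(x, t) \<in> open_segment (x, s) (x, t')"
      by (auto simp: in_segment algebra_simps)
    ultimately show ?thesis
      using face_ofD[OF F _ _ xt' xt] by blast
  qed
  then have "{..<t} \<subseteq> snd ` F"
    by force
  then have "bdd_below {..<t}"
    using \<open>bounded F\<close> bounded_snd bounded_subset bounded_imp_bdd_below by metis
  then obtain B where "B \<le> s" if "s < t" for s
    unfolding bdd_below_def by blast
  from this[of "min B t - 1"] show False by linarith
qed

lemma bounded_face_hypograph_hull:
  assumes F: "F face_of hypograph_hull Q c" and "bounded F"
  obtains K where "K \<subseteq> vertices Q" "F = convex hull (lift c ` K)"
proof -
  let ?K = "{v \<in> vertices Q. lift c v \<in> F}"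
  have "s = Poly_Mapping.lookup c v" if "(v, s) \<in> F \<inter> lower_rays Q c" for v s
    using that lower_raysD[of v s Q c] lift_in_hypograph_hull[of v Q c]
      bounded_face_hypograph_hull_top[OF assms, of v s "Poly_Mapping.lookup c v"]
    by (auto simp: lift_def intro: order.antisym)
  then have "F \<inter> lower_rays Q c = lift c ` ?K"
    by (fastforce simp: lift_def lower_rays_def)
  then have "F = convex hull (lift c ` ?K)"
    using face_of_convex_hull_eq_hull_Int F unfolding hypograph_hull_eq by metis
  then show thesis
    by (rule that[rotated]) blast
qed

lemma lift_in_bounded_face:
  assumes F: "F face_of hypograph_hull Q c" "bounded F" and v: "v \<in> vertices Q" "v \<in> fst ` F"
    and Q: "convex Q"
  shows "lift c v \<in> F"
proof -
  obtain K where K: "K \<subseteq> vertices Q" and FK: "F = convex hull (lift c ` K)"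
    using bounded_face_hypograph_hull[OF F] .
  have "K \<subseteq> Q"
    using K by (auto simp: vertices_def extreme_point_of_def)
  then have "convex hull K \<subseteq> Q"
    using Q by (rule hull_minimal)
  then have "v extreme_point_of convex hull K"
    using v by (auto simp: FK fst_hull_lift vertices_def extreme_point_of_def)
  then have "v \<in> K"
    by (rule extreme_point_of_convex_hull)
  then show ?thesis
    unfolding FK by (intro hull_inc imageI)
qed

text \<open>Otherwise the point over \<open>p\<close> could be lowered until the two midpoints agree, and the face
  property would put \<open>p\<close> into the cell.\<close>

lemma bounded_face_lookup_sum_less:
  assumes F: "F face_of hypograph_hull Q c" "bounded F" and Q: "convex Q"
    and V: "u \<in> vertices Q" "v \<in> vertices Q" "p \<in> vertices Q" "q \<in> vertices Q"
    and mid: "p + q = u + v"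
    and uv: "u \<in> fst ` F" "v \<in> fst ` F" and p: "p \<notin> fst ` F"
  shows "Poly_Mapping.lookup c p + Poly_Mapping.lookup c q
    < Poly_Mapping.lookup c u + Poly_Mapping.lookup c v"
proof (rule ccontr)
  let ?c = "Poly_Mapping.lookup c"
  define d where "d = (?c p + ?c q) - (?c u + ?c v)"
  assume "\<not> ?c p + ?c q < ?c u + ?c v"
  then have "(p, ?c p - d) \<in> hypograph_hull Q c" "(q, ?c q) \<in> hypograph_hull Q c"
    using V by (simp_all add: vertex_in_hypograph_hull d_def)
  moreover have "closed_segment (lift c u) (lift c v) \<subseteq> F"
    using lift_in_bounded_face[OF F _ _ Q] V(1,2) uv face_of_imp_convex[OF F(1)]
    by (simp add: closed_segment_subset)
  then have "midpoint (lift c u) (lift c v) \<in> F"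
    using midpoint_in_closed_segment by blast
  then have midF: "midpoint (p, ?c p - d) (q, ?c q) \<in> F"
    by (simp add: midpoint_def lift_def d_def mid)
  moreover have "p \<noteq> q"
  proof
    assume "p = q"
    then have "fst (midpoint (p, ?c p - d) (q, ?c q)) = p"
      by (simp add: midpoint_def flip: scaleR_2)
    then show False
      using midF p by (metis image_eqI)
  qed
  then have "midpoint (p, ?c p - d) (q, ?c q) \<in> open_segment (p, ?c p - d) (q, ?c q)"
    by simp
  ultimately have "(p, ?c p - d) \<in> F"
    using face_ofD[OF F(1)] by blast
  then show False
    using p by force
qed

definition regular_cell :: "'v::euclidean_space set \<Rightarrow> ('v \<Rightarrow>\<^sub>0 real) \<Rightarrow> 'v set \<Rightarrow> bool" where
  "regular_cell Q c K \<longleftrightarrow> K \<subseteq> vertices Q \<and> K \<noteq> {} \<and> aff_dim K = aff_dim (vertices Q) \<and>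
    (\<exists>z b. (\<forall>v\<in>K. Poly_Mapping.lookup c v = z \<bullet> v + b) \<and>
      (\<forall>v\<in>vertices Q - K. Poly_Mapping.lookup c v < z \<bullet> v + b))"

lemma aff_dim_hypograph_hull_le: "aff_dim (hypograph_hull Q c) \<le> aff_dim (vertices Q) + 1"
proof (cases "vertices Q = {}")
  case False
  then obtain v0 where v0: "v0 \<in> vertices Q" by blast
  let ?S = "insert (v0, 1) ((\<lambda>v. (v, 0 \<bullet> v + 0)) ` vertices Q)"
  have "(v, s) \<in> affine hull ?S" if "v \<in> vertices Q" for v s
  proof -
    have "(v, 0) + s *\<^sub>R ((v0, 1) - (v0, 0)) \<in> affine hull ?S"
      using that v0 by (intro mem_affine_3_minus) (auto intro: hull_inc)
    then show ?thesis by simp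
  qed
  then have "hypograph_hull Q c \<subseteq> affine hull ?S"
    unfolding hypograph_hull_def by (intro hull_minimal affine_imp_convex) auto
  then have "aff_dim (hypograph_hull Q c) \<le> aff_dim ?S"
    by (metis aff_dim_affine_hull aff_dim_subset)
  also have "\<dots> \<le> aff_dim (vertices Q) + 1"
    by (simp only: aff_dim_insert aff_dim_graph) simp
  finally show ?thesis .
qed (simp add: hypograph_hull_def)

lemma supporting_face_hypograph_hull:
  assumes K: "K \<subseteq> vertices Q"
    and on_K: "\<And>v. v \<in> K \<Longrightarrow> Poly_Mapping.lookup c v = z \<bullet> v + b"
    and off_K: "\<And>v. v \<in> vertices Q - K \<Longrightarrow> Poly_Mapping.lookup c v < z \<bullet> v + b"
  shows "hypograph_hull Q c \<inter> {y. (- z, 1) \<bullet> y = b} = convex hull (lift c ` K)"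
    and "convex hull (lift c ` K) face_of hypograph_hull Q c"
proof -
  let ?T = "hypograph_hull Q c" and ?H = "{y. (- z, 1) \<bullet> y = b}"
  have "lower_rays Q c \<subseteq> {y. (- z, 1) \<bullet> y \<le> b}"
    using on_K off_K by (fastforce simp: lower_rays_def)
  then have "?T \<subseteq> {y. (- z, 1) \<bullet> y \<le> b}"
    unfolding hypograph_hull_eq by (intro hull_minimal convex_halfspace_le)
  then have face: "?T \<inter> ?H face_of ?T"
    by (intro face_of_Int_supporting_hyperplane_le convex_hypograph_hull) auto
  have "?H \<inter> lower_rays Q c = lift c ` K"
    using on_K off_K K by (fastforce simp: lower_rays_def lift_def)
  moreover have "lower_rays Q c \<subseteq> ?T"
    by (simp add: hypograph_hull_eq hull_subset)
  ultimately have "?T \<inter> ?H \<inter> lower_rays Q c = lift c ` K"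
    by blast
  then show "?T \<inter> ?H = convex hull (lift c ` K)"
    using face_of_convex_hull_eq_hull_Int face unfolding hypograph_hull_eq by metis
  with face show "convex hull (lift c ` K) face_of ?T"
    by simp
qed

lemma regular_cell_facet:
  assumes "regular_cell Q c K"
  shows "convex hull (lift c ` K) facet_of hypograph_hull Q c"
proof -
  let ?F = "convex hull (lift c ` K)" and ?T = "hypograph_hull Q c"
  obtain z b where on_K: "\<And>v. v \<in> K \<Longrightarrow> Poly_Mapping.lookup c v = z \<bullet> v + b"
      and off_K: "\<And>v. v \<in> vertices Q - K \<Longrightarrow> Poly_Mapping.lookup c v < z \<bullet> v + b"
    and K: "K \<subseteq> vertices Q" "K \<noteq> {}" "aff_dim K = aff_dim (vertices Q)"
    using assms unfolding regular_cell_def by blast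
  have face: "?T \<inter> {y. (- z, 1) \<bullet> y = b} = ?F" "?F face_of ?T"
    using supporting_face_hypograph_hull[of K Q c z b] K(1) on_K off_K by blast+
  obtain v where "v \<in> K" using K(2) by blast
  then have "(v, Poly_Mapping.lookup c v - 1) \<in> ?T - {y. (- z, 1) \<bullet> y = b}"
    using on_K K(1) by (auto intro: vertex_in_hypograph_hull)
  then have "?F \<noteq> ?T"
    using face(1) by blast
  then have "aff_dim ?F < aff_dim ?T"
    by (rule face_of_aff_dim_lt[OF convex_hypograph_hull face(2)])
  moreover have "lift c ` K = (\<lambda>v. (v, z \<bullet> v + b)) ` K"
    using on_K by (simp add: lift_def)
  then have "aff_dim ?F = aff_dim (vertices Q)"
    using K(3) by (simp add: aff_dim_convex_hull aff_dim_graph)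
  moreover have "?F \<noteq> {}"
    using K(2) by simp
  ultimately show ?thesis
    using face(2) aff_dim_hypograph_hull_le[of Q c] by (simp add: facet_of_def)
qed

lemma bounded_regular_cell:
  assumes "finite (vertices Q)" "regular_cell Q c K"
  shows "bounded (convex hull (lift c ` K))"
  using assms unfolding regular_cell_def
  by (meson bounded_convex_hull finite_imageI finite_imp_bounded finite_subset)

lemma bounded_facet_eq_regular_cell:
  assumes fin: "finite (vertices Q)" and K: "regular_cell Q c K"
    and G: "G facet_of hypograph_hull Q c" "bounded G"
    and xt: "(x, t) \<in> rel_interior G" and x: "x \<in> convex hull K"
  shows "G = convex hull (lift c ` K)"
proof -
  let ?F = "convex hull (lift c ` K)"
  have F: "?F facet_of hypograph_hull Q c" "bounded ?F"
    using fin K by (simp_all add: regular_cell_facet bounded_regular_cell)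
  obtain s where s: "(x, s) \<in> ?F"
    using x by (force simp flip: fst_hull_lift[of c])
  have xtG: "(x, t) \<in> G"
    using xt rel_interior_subset by blast
  have "(x, t) \<in> hypograph_hull Q c" "(x, s) \<in> hypograph_hull Q c"
    using xtG s F(1) G(1) facet_of_imp_subset by blast+
  then have "t \<le> s" "s \<le> t"
    using bounded_face_hypograph_hull_top facet_of_imp_face_of F G s xtG by blast+
  then show ?thesis
    using facet_of_eq[OF F(1) G(1)] xt s by auto
qed

theorem regular_subdivision_eqI:
  assumes fin: "finite (vertices Q)"
    and cells: "\<And>K. K \<in> \<K> \<Longrightarrow> regular_cell Q c K"
    and cover: "convex hull vertices Q \<subseteq> (\<Union>K\<in>\<K>. convex hull K)"
  shows "regular_subdivision Q c = (hull) convex ` \<K>"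
proof (intro equalityI subsetI)
  fix P assume "P \<in> (hull) convex ` \<K>"
  then obtain K where K: "K \<in> \<K>" "P = fst ` (convex hull (lift c ` K))"
    by (auto simp: fst_hull_lift)
  then show "P \<in> regular_subdivision Q c"
    using cells[OF K(1)] bounded_regular_cell[OF fin] regular_cell_facet
    unfolding regular_subdivision_def by blast
next
  fix P assume "P \<in> regular_subdivision Q c"
  then obtain G where G: "G facet_of hypograph_hull Q c" "bounded G" "P = fst ` G"
    unfolding regular_subdivision_def by blast
  then have "rel_interior G \<noteq> {}"
    by (auto simp: facet_of_def face_of_imp_convex rel_interior_eq_empty)
  then obtain x t where xt: "(x, t) \<in> rel_interior G"
    by auto
  then have "(x, t) \<in> hypograph_hull Q c"
    using rel_interior_subset facet_of_imp_subset[OF G(1)] by blast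
  then have "x \<in> convex hull vertices Q"
    by (metis fst_conv fst_hypograph_hull image_eqI)
  then obtain K where K: "K \<in> \<K>" "x \<in> convex hull K"
    using cover by blast
  then have "G = convex hull (lift c ` K)"
    using bounded_facet_eq_regular_cell[OF fin cells G(1,2) xt] by blast
  then show "P \<in> (hull) convex ` \<K>"
    using K(1) G(3) fst_hull_lift by blast
qed

section \<open>Chains in finite distributive lattices\<close>

abbreviation is_chain :: "'a::order set \<Rightarrow> bool" where
  "is_chain \<equiv> Complete_Partial_Order.chain (\<le>)"

definition maximal_chain :: "'a::order set \<Rightarrow> bool" where
  "maximal_chain C \<longleftrightarrow> is_chain C \<and> (\<forall>a. (\<forall>c\<in>C. a \<le> c \<or> c \<le> a) \<longrightarrow> a \<in> C)"

lemma maximal_chain_is_chain: "maximal_chain C \<Longrightarrow> is_chain C"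
  by (simp add: maximal_chain_def)

lemma maximal_chainD: "maximal_chain C \<Longrightarrow> (\<And>c. c \<in> C \<Longrightarrow> a \<le> c \<or> c \<le> a) \<Longrightarrow> a \<in> C"
  by (simp add: maximal_chain_def)

lemma ex_maximal_chain_superset:
  fixes B :: "'a::{finite, order} set"
  assumes "is_chain B"
  shows "\<exists>C. maximal_chain C \<and> B \<subseteq> C"
proof -
  obtain C where C: "is_chain C" "B \<subseteq> C" and max: "\<And>D. is_chain D \<Longrightarrow> C \<subseteq> D \<Longrightarrow> C = D"
    using finite_has_maximal2[of "{C. is_chain C}" B] assms by auto
  have "a \<in> C" if "\<forall>c\<in>C. a \<le> c \<or> c \<le> a" for a
  proof -
    have "is_chain (insert a C)"
      using that C(1) by (auto simp: chain_def)
    then show ?thesis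
      using max[of "insert a C"] by blast
  qed
  then show ?thesis
    using C unfolding maximal_chain_def by blast
qed

lemma finite_chain_greatest:
  assumes "is_chain C" "finite C" "C \<noteq> {}"
  obtains m where "m \<in> C" "\<And>c. c \<in> C \<Longrightarrow> c \<le> m"
  using finite_has_maximal[of C] assms unfolding chain_def by metis

lemma finite_chain_least:
  assumes "is_chain C" "finite C" "C \<noteq> {}"
  obtains m where "m \<in> C" "\<And>c. c \<in> C \<Longrightarrow> m \<le> c"
  using finite_has_minimal[of C] assms unfolding chain_def by metis

lemma ex_least_element: "\<exists>z :: 'a::{finite, lattice}. \<forall>a. z \<le> a"
  by (meson Inf_fin.coboundedI UNIV_I finite)

lemma ex_greatest_element: "\<exists>z :: 'a::{finite, lattice}. \<forall>a. a \<le> z"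
  by (meson Sup_fin.coboundedI UNIV_I finite)

lemma is_chain_sup_inf: "is_chain {sup a b, inf a (b :: 'a::lattice)}"
  by (auto simp: chain_def intro: le_infI1 le_supI1)

lemma maximal_chain_cut:
  fixes C :: "'a::{finite, lattice} set"
  assumes C: "maximal_chain C" and a: "a \<notin> C"
  obtains d c where "d \<in> C" "d \<le> a" "\<And>x. x \<in> C \<Longrightarrow> x \<le> a \<Longrightarrow> x \<le> d"
    and "c \<in> C" "\<not> c \<le> a" "\<And>x. x \<in> C \<Longrightarrow> \<not> x \<le> a \<Longrightarrow> c \<le> x"
proof -
  have chain: "is_chain C"
    using C by (rule maximal_chain_is_chain)
  obtain z :: 'a where bot: "\<forall>a. z \<le> a"
    using ex_least_element by blast
  obtain t :: 'a where top: "\<forall>a. a \<le> t"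
    using ex_greatest_element by blast
  have ends: "z \<in> C" "t \<in> C"
    using bot top maximal_chainD[OF C] by blast+
  let ?below = "{x \<in> C. x \<le> a}" and ?rest = "{x \<in> C. \<not> x \<le> a}"
  have sub_chains: "is_chain ?below" "is_chain ?rest"
    by (auto intro: chain_subset[OF chain])
  have "z \<in> ?below"
    using bot ends by blast
  then have "?below \<noteq> {}" by blast
  then obtain d where d: "d \<in> ?below" "\<And>x. x \<in> ?below \<Longrightarrow> x \<le> d"
    by (rule finite_chain_greatest[OF sub_chains(1) finite]) blast
  have "t \<in> ?rest"
    using top ends a by (auto dest: order.antisym)
  then have "?rest \<noteq> {}" by blast
  then obtain c where c: "c \<in> ?rest" "\<And>x. x \<in> ?rest \<Longrightarrow> c \<le> x"
    by (rule finite_chain_least[OF sub_chains(2) finite]) blast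
  show thesis
    by (rule that[of d c]) (use d c in blast)+
qed

lemma maximal_chain_incomparable_inf_mem:
  fixes C :: "'a::{finite, lattice} set"
  assumes C: "maximal_chain C" and a: "a \<notin> C"
  obtains c where "c \<in> C" "inf a c \<in> C" "\<not> a \<le> c" "\<not> c \<le> a"
proof -
  obtain d c where d: "d \<in> C" "d \<le> a" "\<And>x. x \<in> C \<Longrightarrow> x \<le> a \<Longrightarrow> x \<le> d"
    and c: "c \<in> C" "\<not> c \<le> a" "\<And>x. x \<in> C \<Longrightarrow> \<not> x \<le> a \<Longrightarrow> c \<le> x"
    by (rule maximal_chain_cut[OF assms]) blast
  have "d \<le> c"
    using chainD[OF maximal_chain_is_chain[OF C] d(1) c(1)] d(2) c(2) order.trans by blast
  have "inf a c \<in> C"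
    using C
  proof (rule maximal_chainD)
    fix x assume "x \<in> C"
    show "inf a c \<le> x \<or> x \<le> inf a c"
    proof (cases "x \<le> a")
      case True
      then have "x \<le> d" using d(3) \<open>x \<in> C\<close> by blast
      then have "x \<le> inf a c" using True \<open>d \<le> c\<close> by (meson inf.boundedI order.trans)
      then show ?thesis ..
    next
      case False
      then have "c \<le> x" using c(3) \<open>x \<in> C\<close> by blast
      then show ?thesis by (simp add: le_infI2)
    qed
  qed
  moreover from this have "\<not> a \<le> c"
    using a by (metis inf.absorb1)
  ultimately show thesis
    using that c(1,2) by blast
qed

lemma maximal_chain_induct [consumes 1, case_names chain step]:
  fixes C :: "'a::{finite, lattice} set"
  assumes C: "maximal_chain C"
    and chain: "\<And>c. c \<in> C \<Longrightarrow> P c"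
    and step: "\<And>a c. a \<notin> C \<Longrightarrow> c \<in> C \<Longrightarrow> inf a c \<in> C \<Longrightarrow> \<not> a \<le> c \<Longrightarrow> \<not> c \<le> a \<Longrightarrow>
      P (sup a c) \<Longrightarrow> P a"
  shows "P a"
proof -
  have "wfp ((>) :: 'a \<Rightarrow> 'a \<Rightarrow> bool)"
    by (intro strict_partial_order_wfp_on_finite_set finite) (auto simp: asymp_on_def transp_on_def)
  then show ?thesis
  proof (induction a rule: wfp_induct_rule)
    case (less a)
    show ?case
    proof (cases "a \<in> C")
      case False
      then obtain c where c: "c \<in> C" "inf a c \<in> C" "\<not> a \<le> c" "\<not> c \<le> a"
        using maximal_chain_incomparable_inf_mem[OF C] by blast
      then have "sup a c > a"
        by (metis less_le sup.cobounded1 sup.cobounded2)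
      then show ?thesis
        using less step[OF False c] by blast
    qed (rule chain)
  qed
qed

section \<open>The order polytope\<close>

lemma join_irreducible_le_sup_iff:
  assumes "join_irreducible p"
  shows "p \<le> sup a b \<longleftrightarrow> p \<le> a \<or> p \<le> b"
proof
  assume "p \<le> sup a b"
  then have "p = sup (inf p a) (inf p b)"
    by (metis inf.absorb1 inf_sup_distrib1)
  then have "p = inf p a \<or> p = inf p b"
    using assms unfolding join_irreducible_def by blast
  then show "p \<le> a \<or> p \<le> b"
    by (metis inf_le2)
qed (auto intro: le_supI1 le_supI2)

lemma birkhoff_sup: "birkhoff (sup a b) = birkhoff a \<union> birkhoff b"
  by (auto simp: birkhoff_def join_irreducible_le_sup_iff)

lemma birkhoff_inf: "birkhoff (inf a b) = birkhoff a \<inter> birkhoff b"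
  by (auto simp: birkhoff_def)

lemma birkhoff_subset_iff: "birkhoff a \<subseteq> birkhoff b \<longleftrightarrow> a \<le> b"
  by (metis (no_types, lifting) birkhoff_def le_if_birkhoff_subset mem_Collect_eq order_trans
      subsetI)

lemma birkhoff_psubset_iff: "birkhoff a \<subset> birkhoff b \<longleftrightarrow> a < b"
  by (simp add: less_le_not_le birkhoff_subset_iff)

lemma ex_birkhoff_eq:
  fixes S :: "'a::{finite, distrib_lattice} set"
  assumes irr: "\<And>p. p \<in> S \<Longrightarrow> join_irreducible p"
    and down: "\<And>p q. p \<in> S \<Longrightarrow> join_irreducible q \<Longrightarrow> q < p \<Longrightarrow> q \<in> S"
  shows "\<exists>a. birkhoff a = S"
proof -
  have "\<exists>a. birkhoff a = (\<Union>s\<in>T. birkhoff s)" if "finite T" for T :: "'a set"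
    using that
  proof induction
    case empty
    obtain z :: 'a where "\<forall>a. z \<le> a"
      using ex_least_element by blast
    then have "birkhoff z = {}"
      unfolding birkhoff_def join_irreducible_def using leD order.strict_trans2 by blast
    then show ?case by auto
  next
    case (insert x T)
    then show ?case by (metis UN_insert birkhoff_sup)
  qed
  moreover have "(\<Union>s\<in>S. birkhoff s) = S"
  proof
    show "(\<Union>s\<in>S. birkhoff s) \<subseteq> S"
      using down by (force simp: birkhoff_def order_le_less)
    show "S \<subseteq> (\<Union>s\<in>S. birkhoff s)"
      using irr by (force simp: birkhoff_def)
  qed
  ultimately show ?thesis by (metis finite)
qed

lemma ideal_vertex_nth: "ideal_vertex a $ p = (if p \<in> birkhoff a then 1 else 0)"
  by (simp add: ideal_vertex_def indicator_def)

lemma ideal_vertex_sup_inf: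
  "ideal_vertex (sup a b) + ideal_vertex (inf a b) = ideal_vertex a + ideal_vertex b"
  by (simp add: vec_eq_iff ideal_vertex_nth birkhoff_sup birkhoff_inf)

lemma affine_independent_ideal_vertex_chain:
  fixes C :: "'a::{finite, distrib_lattice} set"
  assumes "is_chain C"
  shows "\<not> affine_dependent (ideal_vertex ` C)"
  using finite[of C] assms
proof (induction C rule: finite_remove_induct)
  case (remove C)
  obtain m where m: "m \<in> C" "\<And>c. c \<in> C \<Longrightarrow> c \<le> m"
    by (rule finite_chain_greatest[OF remove.prems remove.hyps(1,2)]) blast
  let ?D = "C - {m}"
  have D: "is_chain ?D"
    using remove.prems by (rule chain_subset) blast
  have "ideal_vertex m \<notin> affine hull (ideal_vertex ` ?D)"
  proof (cases "?D = {}")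
    case False
    obtain d where d: "d \<in> ?D" "\<And>c. c \<in> ?D \<Longrightarrow> c \<le> d"
      by (rule finite_chain_greatest[OF D finite False]) blast
    then have "d < m"
      using m by (auto simp: less_le)
    then obtain p where p: "p \<in> birkhoff m" "p \<notin> birkhoff d"
      using birkhoff_psubset_iff by blast
    have "affine {x :: (real, 'a) vec. x $ p = 0}"
      using affine_hyperplane[of "axis p (1 :: real)" 0] by (simp add: inner_axis')
    moreover have "p \<notin> birkhoff c" if "c \<in> ?D" for c
      using p(2) d(2)[OF that] birkhoff_subset_iff by blast
    then have "ideal_vertex ` ?D \<subseteq> {x. x $ p = 0}"
      by (auto simp: ideal_vertex_nth)
    ultimately have "affine hull (ideal_vertex ` ?D) \<subseteq> {x. x $ p = 0}"
      by (rule hull_minimal[rotated])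
    then show ?thesis
      using p(1) by (auto simp: ideal_vertex_nth)
  qed (simp only: image_empty affine_hull_empty empty_iff not_False_eq_True)
  then have "\<not> affine_dependent (insert (ideal_vertex m) (ideal_vertex ` ?D))"
    using remove.IH[OF m(1) D] by (intro affine_independent_insert)
  then show ?case
    using m(1) by (simp flip: image_insert add: insert_absorb)
qed simp

lemma ideal_vertex_in_affine_hull_maximal_chain:
  fixes C :: "'a::{finite, distrib_lattice} set"
  assumes "maximal_chain C"
  shows "ideal_vertex a \<in> affine hull (ideal_vertex ` C)"
  using assms
proof (induction a rule: maximal_chain_induct)
  case (chain c)
  then show ?case by (simp add: hull_inc)
next
  case (step a c)
  then have "ideal_vertex (sup a c) + 1 *\<^sub>R (ideal_vertex (inf a c) - ideal_vertex c)
      \<in> affine hull (ideal_vertex ` C)"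
    by (intro mem_affine_3_minus) (auto intro: hull_inc)
  moreover have
    "ideal_vertex (sup a c) + (ideal_vertex (inf a c) - ideal_vertex c) = ideal_vertex a"
    using ideal_vertex_sup_inf[of a c] by (simp add: algebra_simps)
  ultimately show ?case by simp
qed

lemma aff_dim_maximal_chain:
  fixes C :: "'a::{finite, distrib_lattice} set"
  assumes "maximal_chain C"
  shows "aff_dim (ideal_vertex ` C) = aff_dim (range (ideal_vertex :: 'a \<Rightarrow> _))"
proof (rule antisym)
  show "aff_dim (ideal_vertex ` C) \<le> aff_dim (range (ideal_vertex :: 'a \<Rightarrow> _))"
    by (intro aff_dim_subset) blast
  have "range ideal_vertex \<subseteq> affine hull (ideal_vertex ` C)"
    using ideal_vertex_in_affine_hull_maximal_chain[OF assms] by blast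
  then show "aff_dim (range (ideal_vertex :: 'a \<Rightarrow> _)) \<le> aff_dim (ideal_vertex ` C)"
    by (metis aff_dim_affine_hull aff_dim_subset)
qed

lemma ideal_vertex_in_order_polytope: "ideal_vertex a \<in> order_polytope"
  by (auto simp: order_polytope_def ideal_vertex_nth birkhoff_def)

lemma order_polytope_nth_bounds:
  assumes "x \<in> order_polytope"
  shows "0 \<le> x $ p" "x $ p \<le> 1"
  using assms by (cases "join_irreducible p"; auto simp: order_polytope_def)+

lemma convex_order_polytope: "convex order_polytope"
proof -
  have "convex {x :: (real, 'a) vec. x $ p = 0}" "convex {x :: (real, 'a) vec. 0 \<le> x $ p}"
    "convex {x :: (real, 'a) vec. x $ p \<le> 1}" "convex {x :: (real, 'a) vec. x $ p \<le> x $ q}" for p q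
    by (auto simp: convex_def add_mono mult_left_mono convex_bound_le)
  moreover have eq: "order_polytope =
      (\<Inter>p\<in>- Collect join_irreducible. {x :: (real, 'a) vec. x $ p = 0}) \<inter>
      (\<Inter>p\<in>Collect join_irreducible. {x. 0 \<le> x $ p} \<inter> {x. x $ p \<le> 1} \<inter>
        (\<Inter>q\<in>{q. join_irreducible q \<and> q < p}. {x. x $ p \<le> x $ q}))"
    by (auto simp: order_polytope_def)
  ultimately show ?thesis
    unfolding eq by (intro convex_Int convex_INT)
qed

lemma order_polytope_support:
  assumes "x \<in> order_polytope"
  obtains a where "birkhoff a = {p. x $ p \<noteq> 0}"
proof -
  have "q \<in> {p. x $ p \<noteq> 0}" if "p \<in> {p. x $ p \<noteq> 0}" "join_irreducible q" "q < p" for p q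
    using that assms order_polytope_nth_bounds(1)[OF assms, of p]
    by (force simp: order_polytope_def)
  moreover have "join_irreducible p" if "p \<in> {p. x $ p \<noteq> 0}" for p
    using that assms by (auto simp: order_polytope_def)
  ultimately show thesis
    using ex_birkhoff_eq[of "{p. x $ p \<noteq> 0}"] that by blast
qed

lemma order_polytope_split_support:
  assumes x: "x \<in> order_polytope" and a: "birkhoff a = {p. x $ p \<noteq> 0}"
    and m: "\<And>p. p \<in> birkhoff a \<Longrightarrow> m \<le> x $ p" "m < 1"
  obtains y where "y \<in> order_polytope" "x = m *\<^sub>R ideal_vertex a + (1 - m) *\<^sub>R y"
    "\<And>p. y $ p \<noteq> 0 \<longleftrightarrow> x $ p \<noteq> 0 \<and> x $ p \<noteq> m"
proof
  define y where "y = (1 / (1 - m)) *\<^sub>R (x - m *\<^sub>R ideal_vertex a)"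
  have y: "y $ p = (if x $ p = 0 then 0 else (x $ p - m) / (1 - m))" for p
    using a by (auto simp: y_def ideal_vertex_nth set_eq_iff)
  have m': "m \<le> x $ p" if "x $ p \<noteq> 0" for p
    using m(1) that a by blast
  show "x = m *\<^sub>R ideal_vertex a + (1 - m) *\<^sub>R y"
    using m(2) by (simp add: y_def)
  show "y $ p \<noteq> 0 \<longleftrightarrow> x $ p \<noteq> 0 \<and> x $ p \<noteq> m" for p
    using m(2) by (simp add: y)
  have "y $ p \<le> y $ q" if "x $ p \<le> x $ q" for p q
    using that m(2) m' order_polytope_nth_bounds(1)[OF x, of p] by (auto simp: y divide_right_mono)
  moreover have "0 \<le> y $ p" "y $ p \<le> 1" for p
    using m(2) m' order_polytope_nth_bounds(2)[OF x, of p] by (auto simp: y divide_simps)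
  ultimately show "y \<in> order_polytope"
    using x by (auto simp: order_polytope_def y)
qed

lemma order_polytope_peel_support:
  assumes x: "x \<in> order_polytope" and a: "birkhoff a = {p. x $ p \<noteq> 0}"
    and neq: "x \<noteq> ideal_vertex a"
  obtains m y where "0 \<le> m" "m \<le> 1" "y \<in> order_polytope"
    "x = m *\<^sub>R ideal_vertex a + (1 - m) *\<^sub>R y" "{p. y $ p \<noteq> 0} \<subset> {p. x $ p \<noteq> 0}"
proof -
  obtain q where q: "q \<in> birkhoff a" "x $ q \<noteq> 1"
    using neq a by (auto simp: vec_eq_iff ideal_vertex_nth split: if_splits)
  define m where "m = Min (($) x ` birkhoff a)"
  have m_le: "m \<le> x $ p" if "p \<in> birkhoff a" for p
    using that by (simp add: m_def)
  have "m < 1"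
    using m_le[OF q(1)] q(2) order_polytope_nth_bounds(2)[OF x, of q] by simp
  obtain p where p: "p \<in> birkhoff a" "x $ p = m"
    using Min_in[of "($) x ` birkhoff a"] q(1) unfolding m_def
    by (metis empty_iff finite finite_imageI image_iff)
  obtain y where y: "y \<in> order_polytope" "x = m *\<^sub>R ideal_vertex a + (1 - m) *\<^sub>R y"
    and supp: "\<And>p. y $ p \<noteq> 0 \<longleftrightarrow> x $ p \<noteq> 0 \<and> x $ p \<noteq> m"
    using order_polytope_split_support[OF x a m_le \<open>m < 1\<close>] by blast
  have "{p. y $ p \<noteq> 0} \<subset> {p. x $ p \<noteq> 0}"
    using supp p a by blast
  moreover have "0 \<le> m"
    using order_polytope_nth_bounds(1)[OF x, of p] p(2) by simp
  ultimately show thesis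
    using that \<open>m < 1\<close> y less_imp_le by metis
qed

lemma order_polytope_chain_decomposition:
  fixes x :: "(real, 'a::{finite, distrib_lattice}) vec"
  assumes "x \<in> order_polytope"
  shows "\<exists>C. is_chain C \<and> (\<forall>c\<in>C. birkhoff c \<subseteq> {p. x $ p \<noteq> 0}) \<and>
    x \<in> convex hull (ideal_vertex ` C)"
  using assms
proof (induction "card {p. x $ p \<noteq> 0}" arbitrary: x rule: less_induct)
  case (less x)
  obtain a where a: "birkhoff a = {p. x $ p \<noteq> 0}"
    using order_polytope_support[OF less.prems] .
  show ?case
  proof (cases "x = ideal_vertex a")
    case True
    then show ?thesis
      using a by (intro exI[of _ "{a}"]) (auto simp: chain_def)
  next
    case False
    then obtain m y where m: "0 \<le> m" "m \<le> 1" and y: "y \<in> order_polytope"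
        "x = m *\<^sub>R ideal_vertex a + (1 - m) *\<^sub>R y" "{p. y $ p \<noteq> 0} \<subset> {p. x $ p \<noteq> 0}"
      using order_polytope_peel_support[OF less.prems a] by metis
    then obtain C where C: "is_chain C" "\<forall>c\<in>C. birkhoff c \<subseteq> {p. y $ p \<noteq> 0}"
      and yC: "y \<in> convex hull (ideal_vertex ` C)"
      using less.hyps[OF psubset_card_mono[OF finite y(3)] y(1)] by blast
    have below: "birkhoff c \<subseteq> birkhoff a" if "c \<in> C" for c
      using C(2) that y(3) a by blast
    then have "is_chain (insert a C)"
      using C(1) by (auto simp: chain_def birkhoff_subset_iff)
    moreover have "y \<in> convex hull (ideal_vertex ` insert a C)"
      using yC hull_mono[of "ideal_vertex ` C" "ideal_vertex ` insert a C"] by blast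
    then have "x \<in> convex hull (ideal_vertex ` insert a C)"
      unfolding y(2) using m by (intro convexD) (auto intro: hull_inc)
    ultimately show ?thesis
      using below a by blast
  qed
qed

lemma order_polytope_maximal_chain_cover:
  assumes "x \<in> order_polytope"
  obtains C where "maximal_chain C" "x \<in> convex hull (ideal_vertex ` C)"
proof -
  obtain B where B: "is_chain B" "x \<in> convex hull (ideal_vertex ` B)"
    using order_polytope_chain_decomposition[OF assms] by blast
  obtain C where C: "maximal_chain C" "B \<subseteq> C"
    using ex_maximal_chain_superset[OF B(1)] by blast
  have "x \<in> convex hull (ideal_vertex ` C)"
    by (rule subsetD[OF hull_mono[OF image_mono[OF C(2)]] B(2)])
  with C(1) show thesis by (rule that)
qed

lemma order_polytope_eq_convex_hull:
  "order_polytope = convex hull (range (ideal_vertex :: 'a::{finite, distrib_lattice} \<Rightarrow> _))"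
proof
  show "order_polytope \<subseteq> convex hull (range (ideal_vertex :: 'a \<Rightarrow> _))"
  proof
    fix x :: "(real, 'a) vec" assume "x \<in> order_polytope"
    then obtain C where "x \<in> convex hull (ideal_vertex ` C)"
      by (rule order_polytope_maximal_chain_cover)
    then show "x \<in> convex hull (range ideal_vertex)"
      using hull_mono[of "ideal_vertex ` C" "range ideal_vertex" convex] by blast
  qed
  show "convex hull (range (ideal_vertex :: 'a \<Rightarrow> _)) \<subseteq> order_polytope"
    by (intro hull_minimal convex_order_polytope) (auto simp: ideal_vertex_in_order_polytope)
qed

lemma zero_one_extreme_point_of:
  fixes S :: "(real ^ 'n) set"
  assumes bounds: "\<And>x i. x \<in> S \<Longrightarrow> 0 \<le> x $ i \<and> x $ i \<le> 1"
    and v: "v \<in> S" "\<And>i. v $ i = 0 \<or> v $ i = 1"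
  shows "v extreme_point_of S"
  unfolding extreme_point_of_def
proof (intro conjI ballI notI)
  fix a b assume ab: "a \<in> S" "b \<in> S" and "v \<in> open_segment a b"
  then obtain u where u: "0 < u" "u < 1" "v = (1 - u) *\<^sub>R a + u *\<^sub>R b" and "a \<noteq> b"
    by (auto simp: in_segment)
  have "a $ i = b $ i" for i
  proof (rule ccontr)
    assume "a $ i \<noteq> b $ i"
    then have "v $ i \<in> open_segment (a $ i) (b $ i)"
      using u by (auto simp: in_segment)
    moreover have "v $ i extreme_point_of closed_segment 0 1"
      using v(2) by (simp add: extreme_point_of_segment)
    ultimately show False
      using bounds[OF ab(1), of i] bounds[OF ab(2), of i]
      by (simp add: extreme_point_of_def closed_segment_eq_real_ivl)
  qed
  then show False
    using \<open>a \<noteq> b\<close> by (simp add: vec_eq_iff)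
qed (fact v)

lemma vertices_order_polytope:
  "vertices order_polytope = range (ideal_vertex :: 'a::{finite, distrib_lattice} \<Rightarrow> _)"
proof
  show "vertices order_polytope \<subseteq> range (ideal_vertex :: 'a \<Rightarrow> _)"
    unfolding vertices_def order_polytope_eq_convex_hull using extreme_point_of_convex_hull by blast
  have "ideal_vertex a extreme_point_of order_polytope" for a :: 'a
    by (rule zero_one_extreme_point_of[OF _ ideal_vertex_in_order_polytope])
      (simp_all add: order_polytope_nth_bounds ideal_vertex_nth)
  then show "range (ideal_vertex :: 'a \<Rightarrow> _) \<subseteq> vertices order_polytope"
    unfolding vertices_def by blast
qed

lemma ideal_vertex_in_hull_iff:
  "ideal_vertex a \<in> convex hull (ideal_vertex ` C) \<longleftrightarrow> a \<in> C"
proof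
  assume a: "ideal_vertex a \<in> convex hull (ideal_vertex ` C)"
  have "convex hull (ideal_vertex ` C) \<subseteq> order_polytope"
    unfolding order_polytope_eq_convex_hull by (intro hull_mono) blast
  moreover have "ideal_vertex a extreme_point_of order_polytope"
    using vertices_order_polytope by (auto simp: vertices_def)
  ultimately have "ideal_vertex a extreme_point_of convex hull (ideal_vertex ` C)"
    using a unfolding extreme_point_of_def by blast
  then have "ideal_vertex a \<in> ideal_vertex ` C"
    by (rule extreme_point_of_convex_hull)
  then show "a \<in> C"
    by (simp add: inj_image_mem_iff[OF inj_ideal_vertex])
qed (simp add: hull_inc)

section \<open>Strictly supermodular functions\<close>

definition strict_supermodular :: "(real, 'a::{finite, lattice}) vec \<Rightarrow> bool" where
  "strict_supermodular w \<longleftrightarrow>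
    (\<forall>a b. \<not> a \<le> b \<and> \<not> b \<le> a \<longrightarrow> w $ a + w $ b < w $ (sup a b) + w $ (inf a b))"

lemma strict_supermodularD:
  "strict_supermodular w \<Longrightarrow> \<not> a \<le> b \<Longrightarrow> \<not> b \<le> a \<Longrightarrow>
    w $ a + w $ b < w $ (sup a b) + w $ (inf a b)"
  by (simp add: strict_supermodular_def)

lemma strict_supermodular_card_square:
  "strict_supermodular (\<chi> a. (real (card (birkhoff a)))\<^sup>2)"
  unfolding strict_supermodular_def
proof (intro allI impI)
  fix a b :: 'a assume inc: "\<not> a \<le> b \<and> \<not> b \<le> a"
  let ?c = "\<lambda>a. real (card (birkhoff a))"
  have "inf a b < a" "inf a b < b"
    using inc by (simp_all add: less_le) (metis inf.cobounded1 inf.cobounded2)+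
  then have "?c (inf a b) < ?c a" "?c (inf a b) < ?c b"
    by (simp_all add: birkhoff_psubset_iff psubset_card_mono)
  then have "0 < (?c a - ?c (inf a b)) * (?c b - ?c (inf a b))"
    by simp
  moreover have "?c (sup a b) = ?c a + ?c b - ?c (inf a b)"
    using card_Un_Int[of "birkhoff a" "birkhoff b"] by (simp add: birkhoff_sup birkhoff_inf)
  then have "(?c (sup a b))\<^sup>2 + (?c (inf a b))\<^sup>2
      = (?c a)\<^sup>2 + (?c b)\<^sup>2 + 2 * ((?c a - ?c (inf a b)) * (?c b - ?c (inf a b)))"
    by (simp only:) (simp add: power2_eq_square algebra_simps)
  ultimately show "(\<chi> a. (?c a)\<^sup>2) $ a + (\<chi> a. (?c a)\<^sup>2) $ b
      < (\<chi> a. (?c a)\<^sup>2) $ (sup a b) + (\<chi> a. (?c a)\<^sup>2) $ (inf a b)"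
    by simp
qed

lemma open_strict_supermodular: "open (Collect strict_supermodular)"
proof -
  have "open (\<Inter>ab\<in>{(a, b). \<not> a \<le> b \<and> \<not> b \<le> (a :: 'a)}. {w :: (real, 'a) vec.
      w $ fst ab + w $ snd ab < w $ (sup (fst ab) (snd ab)) + w $ (inf (fst ab) (snd ab))})"
    by (intro open_INT open_Collect_less ballI continuous_intros finite)
  also have "\<dots> = Collect strict_supermodular"
    by (auto simp: strict_supermodular_def)
  finally show ?thesis .
qed

lemma dim_strict_supermodular:
  "dim (Collect strict_supermodular :: (real, 'a::{finite, distrib_lattice}) vec set) = CARD('a)"
proof -
  let ?D = "Collect strict_supermodular :: (real, 'a) vec set"
  have "interior ?D \<noteq> {}"
    using strict_supermodular_card_square by (auto simp: interior_open open_strict_supermodular)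
  then have "\<not> dim ?D < DIM((real, 'a) vec)"
    using empty_interior_lowdim by blast
  then show ?thesis
    using dim_subset_UNIV[of ?D] by simp
qed

text \<open>The induction goes down from the top: if \<open>c \<in> C\<close> is incomparable to \<open>a\<close> and \<open>a \<and> c \<in> C\<close>,
  then supermodularity makes the gap to the interpolating function strictly larger at \<open>a\<close> than at
  \<open>a \<or> c\<close>.\<close>

lemma strict_supermodular_interpolation:
  assumes w: "strict_supermodular w" and C: "maximal_chain C"
  obtains z b where "\<And>c. c \<in> C \<Longrightarrow> w $ c = z \<bullet> ideal_vertex c + b"
    "\<And>a. a \<notin> C \<Longrightarrow> w $ a < z \<bullet> ideal_vertex a + b"
proof -
  have "\<not> affine_dependent (ideal_vertex ` C)"
    using C by (intro affine_independent_ideal_vertex_chain maximal_chain_is_chain)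
  then obtain z b where "\<And>x. x \<in> ideal_vertex ` C \<Longrightarrow> w $ inv ideal_vertex x = z \<bullet> x + b"
    by (rule affine_independent_interpolation[where f = "\<lambda>x. w $ inv ideal_vertex x"]) blast
  then have on_chain: "w $ c = z \<bullet> ideal_vertex c + b" if "c \<in> C" for c
    using that inv_f_f[OF inj_ideal_vertex, of c] by (metis imageI)
  have "w $ a \<le> z \<bullet> ideal_vertex a + b \<and> (a \<notin> C \<longrightarrow> w $ a < z \<bullet> ideal_vertex a + b)" for a
    using C
  proof (induction a rule: maximal_chain_induct)
    case (chain c)
    then show ?case by (simp add: on_chain)
  next
    case (step a c)
    have "w $ a + w $ c < w $ (sup a c) + w $ (inf a c)"
      using w step(4,5) by (rule strict_supermodularD)
    moreover have "z \<bullet> ideal_vertex (sup a c) + z \<bullet> ideal_vertex (inf a c)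
        = z \<bullet> ideal_vertex a + z \<bullet> ideal_vertex c"
      by (simp add: ideal_vertex_sup_inf flip: inner_add_right)
    ultimately show ?case
      using on_chain[OF step(2)] on_chain[OF step(3)] step.IH by simp
  qed
  then show thesis
    using that on_chain by blast
qed

section \<open>Spans, monomial ideals and initial forms\<close>

abbreviation monomial :: "('a \<Rightarrow>\<^sub>0 nat) \<Rightarrow> 'a poly_ring" where
  "monomial m \<equiv> Poly_Mapping.single m 1"

lemma module_mult: "module ((*) :: 'a poly_ring \<Rightarrow> _)"
  by unfold_locales (auto simp: algebra_simps)

lemma module_const_mult: "module (\<lambda>z (p :: 'a poly_ring). Poly_Mapping.single 0 z * p)"
  by unfold_locales
    (simp_all add: distrib_left distrib_right single_add mult_single mult.assoc[symmetric])

lemmas ideal_gen_base = module.span_base[OF module_mult, folded ideal_gen_def]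
lemmas ideal_gen_zero = module.span_zero[OF module_mult, folded ideal_gen_def]
lemmas ideal_gen_add = module.span_add[OF module_mult, folded ideal_gen_def]
lemmas ideal_gen_mult = module.span_scale[OF module_mult, folded ideal_gen_def]

lemmas complex_span_base = module.span_base[OF module_const_mult, folded complex_span_def]
lemmas complex_span_zero = module.span_zero[OF module_const_mult, folded complex_span_def]
lemmas complex_span_add = module.span_add[OF module_const_mult, folded complex_span_def]
lemmas complex_span_sum = module.span_sum[OF module_const_mult, folded complex_span_def]
lemmas complex_span_const_mult = module.span_scale[OF module_const_mult, folded complex_span_def]

lemma ideal_gen_minimal:
  assumes "S \<subseteq> T" "0 \<in> T" "\<And>p q. p \<in> T \<Longrightarrow> q \<in> T \<Longrightarrow> p + q \<in> T" "\<And>r p. p \<in> T \<Longrightarrow> r * p \<in> T"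
  shows "ideal_gen S \<subseteq> T"
  unfolding ideal_gen_def using assms
  by (intro module.span_minimal module.subspaceI module_mult) auto

lemma complex_span_minimal:
  assumes "S \<subseteq> T" "0 \<in> T" "\<And>p q. p \<in> T \<Longrightarrow> q \<in> T \<Longrightarrow> p + q \<in> T"
    "\<And>z p. p \<in> T \<Longrightarrow> Poly_Mapping.single 0 z * p \<in> T"
  shows "complex_span S \<subseteq> T"
  unfolding complex_span_def using assms
  by (intro module.span_minimal module.subspaceI module_const_mult) auto

lemma lookup_const_mult:
  "Poly_Mapping.lookup (Poly_Mapping.single 0 z * p) m = z * Poly_Mapping.lookup p m"
  by (simp add: map.rep_eq when_def flip: mult_map_scale_conv_mult)

lemma poly_mapping_eq_sum_single:
  "p = (\<Sum>m\<in>Poly_Mapping.keys p. Poly_Mapping.single m (Poly_Mapping.lookup p m))"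
  by (rule poly_mapping_eqI)
    (auto simp: lookup_sum lookup_single when_def in_keys_iff sum.delta'[OF finite_keys])

lemma poly_eq_sum_monomials:
  "p = (\<Sum>m\<in>Poly_Mapping.keys p. Poly_Mapping.single 0 (Poly_Mapping.lookup p m) * monomial m)"
  by (subst poly_mapping_eq_sum_single) (simp add: mult_single)

lemma complex_span_monomials:
  "complex_span (monomial ` M) = {p. Poly_Mapping.keys p \<subseteq> M}" (is "_ = ?T")
proof
  show "complex_span (monomial ` M) \<subseteq> ?T"
  proof (rule complex_span_minimal)
    show "p + q \<in> ?T" if "p \<in> ?T" "q \<in> ?T" for p q
      using that keys_add[of p q] by auto
    show "Poly_Mapping.single 0 z * p \<in> ?T" if "p \<in> ?T" for z p
      using that by (auto simp: in_keys_iff lookup_const_mult subset_iff)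
  qed auto
  have "p \<in> complex_span (monomial ` M)" if "Poly_Mapping.keys p \<subseteq> M" for p
    using that by (subst poly_eq_sum_monomials)
      (rule complex_span_sum, rule complex_span_const_mult, rule complex_span_base, blast)
  then show "?T \<subseteq> complex_span (monomial ` M)"
    by blast
qed

lemma complex_span_mult_closed:
  assumes S: "\<And>m s. s \<in> S \<Longrightarrow> monomial m * s \<in> S" and p: "p \<in> complex_span S"
  shows "r * p \<in> complex_span S"
proof -
  have "complex_span S \<subseteq> {p. monomial m * p \<in> complex_span S}" for m
  proof (rule complex_span_minimal)
    show "S \<subseteq> {p. monomial m * p \<in> complex_span S}"
      using S by (auto intro: complex_span_base)
    show "Poly_Mapping.single 0 z * q \<in> {p. monomial m * p \<in> complex_span S}"
      if "q \<in> {p. monomial m * p \<in> complex_span S}" for z q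
      using that complex_span_const_mult[of "monomial m * q"] by (simp add: mult.left_commute)
  qed (auto simp: complex_span_zero distrib_left intro: complex_span_add)
  then have "Poly_Mapping.single 0 z * (monomial m * p) \<in> complex_span S" for z m
    using p by (intro complex_span_const_mult) blast
  then show ?thesis
    by (subst poly_eq_sum_monomials) (simp only: sum_distrib_right mult.assoc complex_span_sum)
qed

lemma ideal_gen_eq_complex_span:
  "ideal_gen S = complex_span {monomial m * s | m s. s \<in> S}" (is "_ = complex_span ?M")
proof
  have "S \<subseteq> complex_span ?M"
  proof
    fix s assume "s \<in> S"
    then have "monomial 0 * s \<in> complex_span ?M"
      by (intro complex_span_base) blast
    then show "s \<in> complex_span ?M" by simp
  qed
  moreover have "monomial m * t \<in> ?M" if "t \<in> ?M" for m t
  proof -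
    from that obtain n s where "t = monomial n * s" "s \<in> S" by blast
    moreover from this have "monomial m * t = monomial (m + n) * s"
      by (simp add: mult_single flip: mult.assoc)
    ultimately show ?thesis by blast
  qed
  ultimately show "ideal_gen S \<subseteq> complex_span ?M"
    by (intro ideal_gen_minimal complex_span_zero complex_span_add complex_span_mult_closed)
  show "complex_span ?M \<subseteq> ideal_gen S"
    by (intro complex_span_minimal)
      (auto intro: ideal_gen_zero ideal_gen_add ideal_gen_mult ideal_gen_base)
qed

lemma ideal_gen_monomials:
  "ideal_gen (monomial ` M) = complex_span (monomial ` {n + m | n m. m \<in> M})"
proof -
  have "{monomial n * s | n s. s \<in> monomial ` M} = monomial ` {n + m | n m. m \<in> M}"
    by (force simp: mult_single)
  then show ?thesis
    by (simp add: ideal_gen_eq_complex_span)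
qed

lemma lookup_homogeneous_component:
  "Poly_Mapping.lookup (homogeneous_component w d p) m =
    (if grading w m = d then Poly_Mapping.lookup p m else 0)"
proof -
  have "Poly_Mapping.lookup (homogeneous_component w d p) m =
      (\<Sum>n\<in>{n \<in> Poly_Mapping.keys p. grading w n = d}.
        if n = m then Poly_Mapping.lookup p n else 0)"
    by (simp add: homogeneous_component_def lookup_sum lookup_single when_def)
  also have "\<dots> = (if grading w m = d then Poly_Mapping.lookup p m else 0)"
    by (subst sum.delta) (auto simp: in_keys_iff)
  finally show ?thesis .
qed

lemma keys_initial_form:
  "Poly_Mapping.keys (initial_form w p) =
    {m \<in> Poly_Mapping.keys p. \<forall>n\<in>Poly_Mapping.keys p. grading w m \<le> grading w n}"
proof -
  have "grading w m = Min (grading w ` Poly_Mapping.keys p) \<longleftrightarrow>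
      (\<forall>n\<in>Poly_Mapping.keys p. grading w m \<le> grading w n)" if "m \<in> Poly_Mapping.keys p" for m
    using that by (subst eq_commute, subst Min_eq_iff) auto
  then show ?thesis
    by (auto simp: initial_form_def in_keys_iff lookup_homogeneous_component split: if_splits)
qed

lemma lookup_initial_form:
  "Poly_Mapping.lookup (initial_form w p) m =
    (if m \<in> Poly_Mapping.keys (initial_form w p) then Poly_Mapping.lookup p m else 0)"
  by (auto simp: initial_form_def in_keys_iff lookup_homogeneous_component)

lemma keys_monomial_diff: "m \<noteq> n \<Longrightarrow> Poly_Mapping.keys (monomial m - monomial n) = {m, n}"
  by (auto simp: in_keys_iff lookup_minus lookup_single when_def split: if_splits)

lemma initial_form_in_initial_ideal:
  "p \<in> I \<Longrightarrow> p \<noteq> 0 \<Longrightarrow> initial_form w p \<in> initial_ideal w I"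
  unfolding initial_ideal_def by (rule complex_span_base) blast

lemma monomial_in_initial_ideal:
  assumes "monomial m - monomial n \<in> I" and less: "grading w m < grading w n"
  shows "monomial m \<in> initial_ideal w I"
proof -
  have "m \<noteq> n" using less by auto
  then have keys: "Poly_Mapping.keys (initial_form w (monomial m - monomial n)) = {m}"
    using less by (auto simp: keys_initial_form keys_monomial_diff)
  then have "initial_form w (monomial m - monomial n) = monomial m"
    using \<open>m \<noteq> n\<close> by (intro poly_mapping_eqI)
      (auto simp: lookup_initial_form lookup_minus lookup_single when_def)
  moreover have "monomial m - monomial n \<noteq> 0"
    using keys_monomial_diff[OF \<open>m \<noteq> n\<close>] by (metis keys_zero insert_not_empty)
  ultimately show ?thesis
    using initial_form_in_initial_ideal[OF assms(1)] by metis
qed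

text \<open>For \<open>f = hibi_degree\<close> these are the coefficients of the image of \<open>p\<close> in the Hibi ring.\<close>

definition fiber_sum :: "('m \<Rightarrow> 'z) \<Rightarrow> 'z \<Rightarrow> ('m \<Rightarrow>\<^sub>0 'c::comm_monoid_add) \<Rightarrow> 'c" where
  "fiber_sum f z p = (\<Sum>m\<in>Poly_Mapping.keys p. Poly_Mapping.lookup p m when f m = z)"

lemma fiber_sum_superset:
  assumes "finite A" "Poly_Mapping.keys p \<subseteq> A"
  shows "fiber_sum f z p = (\<Sum>m\<in>A. Poly_Mapping.lookup p m when f m = z)"
  unfolding fiber_sum_def using assms by (intro sum.mono_neutral_left) (auto simp: in_keys_iff)

lemma fiber_sum_zero: "fiber_sum f z 0 = 0"
  by (simp add: fiber_sum_def)

lemma fiber_sum_add: "fiber_sum f z (p + q) = fiber_sum f z p + fiber_sum f z q"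
  unfolding fiber_sum_def
  by (rule setsum_keys_plus_distrib[where f = "\<lambda>m c. c when f m = z"])
    (simp_all add: when_add_distrib)

lemma fiber_sum_const_mult:
  fixes p :: "'m::monoid_add \<Rightarrow>\<^sub>0 'c::comm_semiring_0"
  shows "fiber_sum f z (Poly_Mapping.single 0 c * p) = c * fiber_sum f z p"
proof -
  have "fiber_sum f z (Poly_Mapping.single 0 c * p)
      = (\<Sum>m\<in>Poly_Mapping.keys p. c * Poly_Mapping.lookup p m when f m = z)"
    by (subst fiber_sum_superset[of "Poly_Mapping.keys p"])
      (auto simp: lookup_const_mult in_keys_iff)
  then show ?thesis
    by (simp add: fiber_sum_def sum_distrib_left mult_when)
qed

lemma fiber_sum_single: "fiber_sum f z (Poly_Mapping.single m c) = (c when f m = z)"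
  by (subst fiber_sum_superset[of "{m}"]) auto

lemma fiber_sum_eq_lookup:
  assumes "\<And>n. n \<in> Poly_Mapping.keys p \<Longrightarrow> f n = f m \<Longrightarrow> n = m"
  shows "fiber_sum f (f m) p = Poly_Mapping.lookup p m"
proof -
  have "fiber_sum f (f m) p =
      (\<Sum>n\<in>Poly_Mapping.keys p. if n = m then Poly_Mapping.lookup p n else 0)"
    unfolding fiber_sum_def using assms by (intro sum.cong) (auto simp: when_def)
  then show ?thesis
    by (simp add: sum.delta' in_keys_iff)
qed

section \<open>Initial ideals of the Hibi ideal\<close>

definition pair_exponent :: "'a \<Rightarrow> 'a \<Rightarrow> ('a \<Rightarrow>\<^sub>0 nat)" where
  "pair_exponent a b = Poly_Mapping.single a 1 + Poly_Mapping.single b 1"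

definition standard_exponent :: "('a::order \<Rightarrow>\<^sub>0 nat) \<Rightarrow> bool" where
  "standard_exponent m \<longleftrightarrow> is_chain (Poly_Mapping.keys m)"

lemma indet_mult_indet: "indet a * indet b = monomial (pair_exponent a b)"
  by (simp add: indet_def pair_exponent_def mult_single)

lemma keys_add_nat:
  "Poly_Mapping.keys (m + n) = Poly_Mapping.keys m \<union> Poly_Mapping.keys (n :: 'a \<Rightarrow>\<^sub>0 nat)"
  by (auto simp: in_keys_iff lookup_add)

lemma keys_pair_exponent: "Poly_Mapping.keys (pair_exponent a b) = {a, b}"
  by (auto simp: pair_exponent_def keys_add_nat)

lemma exponent_eq_add_pair:
  fixes m :: "'a \<Rightarrow>\<^sub>0 nat"
  assumes "a \<in> Poly_Mapping.keys m" "b \<in> Poly_Mapping.keys m" "a \<noteq> b"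
  shows "m = (m - pair_exponent a b) + pair_exponent a b"
  using assms by (intro poly_mapping_eqI)
    (auto simp: pair_exponent_def lookup_add lookup_minus lookup_single when_def in_keys_iff)

lemma not_standard_exponent_iff:
  "\<not> standard_exponent m \<longleftrightarrow> (\<exists>n a b. m = n + pair_exponent a b \<and> \<not> a \<le> b \<and> \<not> b \<le> a)"
proof
  assume "\<not> standard_exponent m"
  then obtain a b where ab: "a \<in> Poly_Mapping.keys m" "b \<in> Poly_Mapping.keys m" "\<not> a \<le> b" "\<not> b \<le> a"
    by (auto simp: standard_exponent_def chain_def)
  then have "m = (m - pair_exponent a b) + pair_exponent a b"
    by (intro exponent_eq_add_pair) auto
  then show "\<exists>n a b. m = n + pair_exponent a b \<and> \<not> a \<le> b \<and> \<not> b \<le> a"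
    using ab by blast
qed (auto simp: standard_exponent_def chain_def keys_add_nat keys_pair_exponent)

lemma incomparable_ideal_eq_complex_span:
  "incomparable_ideal = complex_span (monomial ` {m. \<not> standard_exponent m})"
proof -
  have "incomparable_ideal
      = ideal_gen (monomial ` {pair_exponent a b | a b :: 'a. \<not> a \<le> b \<and> \<not> b \<le> a})"
    unfolding incomparable_ideal_def indet_mult_indet by (rule arg_cong[of _ _ ideal_gen]) blast
  also have "\<dots> = complex_span (monomial ` {m. \<not> standard_exponent m})"
    unfolding ideal_gen_monomials
    by (intro arg_cong[of _ _ "\<lambda>M. complex_span (monomial ` M)"])
      (auto simp: not_standard_exponent_iff)
  finally show ?thesis .
qed

lemma incomparable_ideal_iff:
  "p \<in> incomparable_ideal \<longleftrightarrow> (\<forall>m\<in>Poly_Mapping.keys p. \<not> standard_exponent m)"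
  by (auto simp: incomparable_ideal_eq_complex_span complex_span_monomials)

lemma hibi_binomial_in_hibi_ideal:
  "monomial (n + pair_exponent a b) - monomial (n + pair_exponent (sup a b) (inf a b)) \<in> hibi_ideal"
proof -
  have "monomial n * (indet a * indet b - indet (sup a b) * indet (inf a b)) \<in> hibi_ideal"
    unfolding hibi_ideal_def by (intro ideal_gen_mult ideal_gen_base) blast
  then show ?thesis
    by (simp add: indet_mult_indet right_diff_distrib mult_single)
qed

definition hibi_degree :: "('a::{finite, distrib_lattice} \<Rightarrow>\<^sub>0 nat) \<Rightarrow> (real, 'a) vec \<times> real" where
  "hibi_degree m =
    (\<Sum>a\<in>UNIV. real (Poly_Mapping.lookup m a) *\<^sub>R ideal_vertex a,
     \<Sum>a\<in>UNIV. real (Poly_Mapping.lookup m a))"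

lemma hibi_degree_add: "hibi_degree (m + n) = hibi_degree m + hibi_degree n"
  by (simp add: hibi_degree_def lookup_add scaleR_left_distrib sum.distrib)

lemma hibi_degree_pair_exponent:
  "hibi_degree (pair_exponent a b) = (ideal_vertex a + ideal_vertex b, 2)"
proof -
  have "hibi_degree (Poly_Mapping.single a 1) = (ideal_vertex a, 1)" for a :: 'a
    by (simp add: hibi_degree_def lookup_single when_def if_distrib[of real]
        if_distrib[of "\<lambda>t. t *\<^sub>R _"] cong: if_cong)
  then show ?thesis
    by (simp add: pair_exponent_def hibi_degree_add)
qed

lemma grading_add: "grading w (m + n) = grading w m + grading w n"
  by (simp add: grading_def lookup_add distrib_right sum.distrib)

lemma grading_pair_exponent: "grading w (pair_exponent a b) = w $ a + w $ b"
proof -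
  have "grading w (Poly_Mapping.single a 1) = w $ a" for a
    by (simp add: grading_def lookup_single when_def if_distrib[of real] if_distrib[of "\<lambda>t. t * _"]
        cong: if_cong)
  then show ?thesis
    by (simp add: pair_exponent_def grading_add)
qed

lemma fiber_sum_hibi_ideal:
  assumes "p \<in> hibi_ideal"
  shows "fiber_sum hibi_degree d p = 0"
proof -
  have binomial: "fiber_sum hibi_degree d
      (monomial n * (indet a * indet b - indet (sup a b) * indet (inf a b))) = 0"
    for n a and b :: 'a
  proof -
    let ?s = "n + pair_exponent a b" and ?t = "n + pair_exponent (sup a b) (inf a b)"
    have "monomial n * (indet a * indet b - indet (sup a b) * indet (inf a b))
        = monomial ?s + Poly_Mapping.single ?t (- 1)"
      by (simp add: indet_mult_indet right_diff_distrib mult_single single_uminus)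
    moreover have "hibi_degree ?t = hibi_degree ?s"
      by (simp add: hibi_degree_add hibi_degree_pair_exponent ideal_vertex_sup_inf)
    ultimately show ?thesis
      by (simp add: fiber_sum_add fiber_sum_single when_def)
  qed
  have "hibi_ideal \<subseteq> {p. fiber_sum hibi_degree d p = 0}"
    unfolding hibi_ideal_def ideal_gen_eq_complex_span
    by (rule complex_span_minimal)
      (auto simp: binomial fiber_sum_zero fiber_sum_add fiber_sum_const_mult)
  with assms show ?thesis by blast
qed

lemma ideal_vertex_chain_coeff_zero:
  fixes \<mu> :: "'a::{finite, distrib_lattice} \<Rightarrow> real"
  assumes C: "is_chain C" and "sum \<mu> C = 0" "(\<Sum>c\<in>C. \<mu> c *\<^sub>R ideal_vertex c) = 0" and "c \<in> C"
  shows "\<mu> c = 0"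
proof -
  let ?\<nu> = "\<lambda>v. \<mu> (inv ideal_vertex v)"
  have "sum ?\<nu> (ideal_vertex ` C) = 0" "(\<Sum>v\<in>ideal_vertex ` C. ?\<nu> v *\<^sub>R v) = 0"
    using assms(2,3)
    by (simp_all add: sum.reindex inj_on_subset[OF inj_ideal_vertex] inv_f_f[OF inj_ideal_vertex])
  then have "?\<nu> (ideal_vertex c) = 0"
    using affine_independent_ideal_vertex_chain[OF C] \<open>c \<in> C\<close>
    unfolding affine_dependent_explicit_finite[OF finite_imageI[OF finite]] by blast
  then show ?thesis
    by (simp add: inv_f_f[OF inj_ideal_vertex])
qed

lemma hibi_degree_inj_on_chain:
  assumes C: "is_chain C" and keys: "Poly_Mapping.keys m \<subseteq> C" "Poly_Mapping.keys n \<subseteq> C"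
    and eq: "hibi_degree m = hibi_degree n"
  shows "m = n"
proof (rule poly_mapping_eqI)
  fix a
  have off: "Poly_Mapping.lookup m c = 0" "Poly_Mapping.lookup n c = 0" if "c \<notin> C" for c
    using keys that by (auto simp: in_keys_iff)
  define \<mu> where "\<mu> = (\<lambda>c. real (Poly_Mapping.lookup m c) - real (Poly_Mapping.lookup n c))"
  have "sum \<mu> C = sum \<mu> UNIV" "(\<Sum>c\<in>C. \<mu> c *\<^sub>R ideal_vertex c) = (\<Sum>c\<in>UNIV. \<mu> c *\<^sub>R ideal_vertex c)"
    using off by (auto simp: \<mu>_def intro!: sum.mono_neutral_left)
  then have "sum \<mu> C = 0" "(\<Sum>c\<in>C. \<mu> c *\<^sub>R ideal_vertex c) = 0"
    using eq by (simp_all add: \<mu>_def hibi_degree_def scaleR_left_diff_distrib sum_subtractf)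
  then have "\<mu> a = 0" if "a \<in> C"
    using that by (rule ideal_vertex_chain_coeff_zero[OF C])
  moreover have "\<mu> a = 0" if "a \<notin> C"
    using off[OF that] by (simp add: \<mu>_def)
  ultimately have "\<mu> a = 0"
    by blast
  then show "Poly_Mapping.lookup m a = Poly_Mapping.lookup n a"
    by (simp add: \<mu>_def)
qed

lemma grading_less_standard:
  assumes w: "strict_supermodular w" and m: "standard_exponent m"
    and eq: "hibi_degree n = hibi_degree m" and "n \<noteq> m"
  shows "grading w n < grading w m"
proof -
  obtain C where C: "maximal_chain C" "Poly_Mapping.keys m \<subseteq> C"
    using ex_maximal_chain_superset m unfolding standard_exponent_def by blast
  obtain z b where on_chain: "\<And>c. c \<in> C \<Longrightarrow> w $ c = z \<bullet> ideal_vertex c + b"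
    and off_chain: "\<And>a. a \<notin> C \<Longrightarrow> w $ a < z \<bullet> ideal_vertex a + b"
    by (rule strict_supermodular_interpolation[OF w C(1)]) blast
  define gap where "gap = (\<lambda>a. z \<bullet> ideal_vertex a + b - w $ a)"
  have gap: "gap a \<ge> 0" "gap a = 0 \<longleftrightarrow> a \<in> C" for a
    using on_chain[of a] off_chain[of a] by (cases "a \<in> C"; simp add: gap_def)+
  have grading: "grading w k = (z, b) \<bullet> hibi_degree k
      - (\<Sum>a\<in>UNIV. real (Poly_Mapping.lookup k a) * gap a)" for k
    by (simp add: grading_def hibi_degree_def gap_def inner_sum_right sum_distrib_left
        algebra_simps sum.distrib sum_subtractf)
  have "\<not> Poly_Mapping.keys n \<subseteq> C"
    using hibi_degree_inj_on_chain[OF maximal_chain_is_chain[OF C(1)] _ C(2) eq] \<open>n \<noteq> m\<close> by blast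
  then obtain a where a: "a \<in> Poly_Mapping.keys n" "a \<notin> C" by blast
  then have "gap a \<noteq> 0"
    using gap(2) by blast
  then have "0 < gap a"
    using gap(1)[of a] by linarith
  then have "0 < real (Poly_Mapping.lookup n a) * gap a"
    using a(1) by (simp add: in_keys_iff)
  then have "0 < (\<Sum>a\<in>UNIV. real (Poly_Mapping.lookup n a) * gap a)"
    using gap(1) by (intro sum_pos2[of _ a]) auto
  moreover have "(\<Sum>a\<in>UNIV. real (Poly_Mapping.lookup m a) * gap a) = 0"
    using C(2) gap(2) by (intro sum.neutral) (auto simp: in_keys_iff)
  ultimately show ?thesis
    by (simp add: grading eq)
qed

lemma initial_ideal_hibi_subset:
  assumes w: "strict_supermodular w"
  shows "initial_ideal w hibi_ideal \<subseteq> incomparable_ideal"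
proof -
  have "initial_form w p \<in> incomparable_ideal" if p: "p \<in> hibi_ideal" for p
    unfolding incomparable_ideal_iff
  proof (intro ballI notI)
    fix m assume "m \<in> Poly_Mapping.keys (initial_form w p)" and m: "standard_exponent m"
    then have mp: "m \<in> Poly_Mapping.keys p"
      and min: "\<And>n. n \<in> Poly_Mapping.keys p \<Longrightarrow> grading w m \<le> grading w n"
      by (auto simp: keys_initial_form)
    have "n = m" if "n \<in> Poly_Mapping.keys p" "hibi_degree n = hibi_degree m" for n
      using grading_less_standard[OF w m that(2)] min[OF that(1)] by fastforce
    then have "fiber_sum hibi_degree (hibi_degree m) p = Poly_Mapping.lookup p m"
      by (rule fiber_sum_eq_lookup)
    then show False
      using fiber_sum_hibi_ideal[OF p] mp by (simp add: in_keys_iff)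
  qed
  then show ?thesis
    unfolding initial_ideal_def incomparable_ideal_def
    by (intro complex_span_minimal) (auto intro: ideal_gen_zero ideal_gen_add ideal_gen_mult)
qed

lemma incomparable_subset_initial_ideal_hibi:
  assumes w: "strict_supermodular w"
  shows "incomparable_ideal \<subseteq> initial_ideal w hibi_ideal"
proof -
  have "monomial m \<in> initial_ideal w hibi_ideal" if m: "\<not> standard_exponent m" for m
  proof -
    from m obtain n a b where "m = n + pair_exponent a b" and inc: "\<not> a \<le> b" "\<not> b \<le> a"
      by (auto simp: not_standard_exponent_iff)
    moreover have
      "grading w (n + pair_exponent a b) < grading w (n + pair_exponent (sup a b) (inf a b))"
      using strict_supermodularD[OF w inc] by (simp add: grading_add grading_pair_exponent)
    ultimately show ?thesis
      using monomial_in_initial_ideal[OF hibi_binomial_in_hibi_ideal] by blast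
  qed
  then show ?thesis
    unfolding incomparable_ideal_eq_complex_span initial_ideal_def
    by (intro complex_span_minimal)
      (auto intro: complex_span_zero complex_span_add complex_span_const_mult)
qed

lemma strict_supermodular_if_initial_ideal_hibi:
  assumes J: "initial_ideal w hibi_ideal = incomparable_ideal"
  shows "strict_supermodular w"
  unfolding strict_supermodular_def
proof (intro allI impI, rule ccontr)
  fix a b :: 'a
  assume inc: "\<not> a \<le> b \<and> \<not> b \<le> a" and ge: "\<not> w $ a + w $ b < w $ (sup a b) + w $ (inf a b)"
  let ?m = "pair_exponent a b" and ?n = "pair_exponent (sup a b) (inf a b)"
  have std: "standard_exponent ?n" "\<not> standard_exponent ?m"
    using inc is_chain_sup_inf[of a b]
    by (auto simp: standard_exponent_def keys_pair_exponent chain_def)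
  then have keys: "Poly_Mapping.keys (monomial ?m - monomial ?n) = {?m, ?n}"
    by (intro keys_monomial_diff) auto
  have "monomial ?m - monomial ?n \<in> hibi_ideal"
    using hibi_binomial_in_hibi_ideal[of 0 a b] by simp
  moreover have "monomial ?m - monomial ?n \<noteq> 0"
    using keys by (metis keys_zero insert_not_empty)
  ultimately have "initial_form w (monomial ?m - monomial ?n) \<in> incomparable_ideal"
    unfolding J[symmetric] by (rule initial_form_in_initial_ideal)
  moreover have "?n \<in> Poly_Mapping.keys (initial_form w (monomial ?m - monomial ?n))"
    using ge by (simp add: keys_initial_form keys grading_pair_exponent)
  ultimately show False
    using std(1) by (simp add: incomparable_ideal_iff)
qed

theorem initial_cone_hibi_incomparable:
  "initial_cone hibi_ideal incomparable_ideal = Collect strict_supermodular"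
  unfolding initial_cone_def
  using strict_supermodular_if_initial_ideal_hibi initial_ideal_hibi_subset
    incomparable_subset_initial_ideal_hibi by blast

section \<open>The canonical triangulation of the order polytope\<close>

definition canonical_triangulation :: "(real, 'a::{finite, distrib_lattice}) vec set set" where
  "canonical_triangulation = {convex hull (ideal_vertex ` C) | C. maximal_chain C}"

lemma regular_cell_maximal_chain:
  assumes w: "strict_supermodular w" and C: "maximal_chain C"
  shows "regular_cell order_polytope (psi w) (ideal_vertex ` C)"
proof -
  obtain z b where "\<And>c. c \<in> C \<Longrightarrow> w $ c = z \<bullet> ideal_vertex c + b"
    "\<And>a. a \<notin> C \<Longrightarrow> w $ a < z \<bullet> ideal_vertex a + b"
    by (rule strict_supermodular_interpolation[OF w C]) blast
  then have "\<exists>z b. (\<forall>v\<in>ideal_vertex ` C. Poly_Mapping.lookup (psi w) v = z \<bullet> v + b) \<and>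
      (\<forall>v\<in>range ideal_vertex - ideal_vertex ` C. Poly_Mapping.lookup (psi w) v < z \<bullet> v + b)"
    by (intro exI[of _ z] exI[of _ b])
      (auto simp: lookup_psi inj_image_mem_iff[OF inj_ideal_vertex])
  moreover have "C \<noteq> {}"
    using maximal_chainD[OF C] by blast
  ultimately show ?thesis
    using aff_dim_maximal_chain[OF C] by (auto simp: regular_cell_def vertices_order_polytope)
qed

lemma regular_subdivision_strict_supermodular:
  assumes "strict_supermodular w"
  shows "regular_subdivision order_polytope (psi w) = canonical_triangulation"
proof -
  let ?\<K> = "{ideal_vertex ` C | C :: 'a set. maximal_chain C}"
  have "convex hull vertices order_polytope \<subseteq> (\<Union>K\<in>?\<K>. convex hull K)"
  proof
    fix x :: "(real, 'a) vec" assume "x \<in> convex hull vertices order_polytope"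
    then have "x \<in> order_polytope"
      by (simp add: vertices_order_polytope flip: order_polytope_eq_convex_hull)
    then obtain C where "maximal_chain C" "x \<in> convex hull (ideal_vertex ` C)"
      by (rule order_polytope_maximal_chain_cover)
    then show "x \<in> (\<Union>K\<in>?\<K>. convex hull K)" by blast
  qed
  then have "regular_subdivision order_polytope (psi w) = (hull) convex ` ?\<K>"
    using regular_cell_maximal_chain[OF assms]
    by (intro regular_subdivision_eqI) (auto simp: vertices_order_polytope)
  then show ?thesis
    by (auto simp: canonical_triangulation_def)
qed

lemma strict_supermodular_if_canonical_triangulation:
  fixes w :: "(real, 'a::{finite, distrib_lattice}) vec"
  assumes sub: "regular_subdivision order_polytope (psi w) = canonical_triangulation"
  shows "strict_supermodular w"
  unfolding strict_supermodular_def
proof (intro allI impI)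
  fix a b :: 'a
  assume inc: "\<not> a \<le> b \<and> \<not> b \<le> a"
  obtain C where C: "maximal_chain C" "sup a b \<in> C" "inf a b \<in> C"
    using ex_maximal_chain_superset[OF is_chain_sup_inf[of a b]] by blast
  then have "convex hull (ideal_vertex ` C) \<in> regular_subdivision order_polytope (psi w)"
    unfolding sub canonical_triangulation_def by blast
  then obtain F where F: "F face_of hypograph_hull order_polytope (psi w)" "bounded F"
    and FC: "convex hull (ideal_vertex ` C) = fst ` F"
    unfolding regular_subdivision_def by (auto dest: facet_of_imp_face_of)
  have "\<not> (a \<in> C \<and> b \<in> C)"
    using maximal_chain_is_chain[OF C(1)] inc by (auto simp: chain_def)
  have sum_less: "w $ p + w $ q < w $ (sup a b) + w $ (inf a b)"
    if "p \<notin> C"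
      and "ideal_vertex p + ideal_vertex q = ideal_vertex a + (ideal_vertex b :: (real, 'a) vec)"
    for p q
  proof -
    have "ideal_vertex p + ideal_vertex q = ideal_vertex (sup a b) + ideal_vertex (inf a b)"
      using that(2) by (simp add: ideal_vertex_sup_inf)
    then show ?thesis
      using bounded_face_lookup_sum_less[OF F convex_order_polytope, of "ideal_vertex (sup a b)"
          "ideal_vertex (inf a b)" "ideal_vertex p" "ideal_vertex q"] C(2,3) that(1)
      by (simp add: vertices_order_polytope lookup_psi ideal_vertex_in_hull_iff flip: FC)
  qed
  from \<open>\<not> (a \<in> C \<and> b \<in> C)\<close> show "w $ a + w $ b < w $ (sup a b) + w $ (inf a b)"
    using sum_less[of a b] sum_less[of b a] by (auto simp: add.commute)
qed

section \<open>The cone of strictly supermodular functions in the secondary fan\<close>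

lemma linear_psi: "linear psi"
proof (rule linearI)
  show "psi (v + w) = psi v + psi w" for v w :: "(real, 'a) vec"
    by (simp add: psi_def single_add sum.distrib)
  have "Poly_Mapping.single k (r * t) = r *\<^sub>R Poly_Mapping.single k t"
    for k :: "(real, 'a) vec" and r t :: real
    by (rule poly_mapping_eqI) (simp add: scaleR_poly_mapping_def lookup_single when_def)
  then show "psi (r *\<^sub>R w) = r *\<^sub>R psi w" for r and w :: "(real, 'a) vec"
    by (simp add: psi_def scaleR_sum_right)
qed

lemma inj_psi: "inj psi"
  by (rule injI) (metis lookup_psi vec_eq_iff)

lemma dim_image_psi: "dim (psi ` S) = dim S"
  by (intro eucl.dim_image_eq linear_psi inj_on_subset[OF inj_psi]) simp

lemma keys_psi: "Poly_Mapping.keys (psi w) \<subseteq> range ideal_vertex"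
  unfolding psi_def by (rule order_trans[OF keys_sum]) auto

lemma coord_space_order_polytope: "coord_space (vertices order_polytope) = range psi"
proof (intro equalityI subsetI)
  fix c :: "(real, 'a) vec \<Rightarrow>\<^sub>0 real" assume "c \<in> coord_space (vertices order_polytope)"
  then have keys: "Poly_Mapping.keys c \<subseteq> range ideal_vertex"
    by (simp add: coord_space_def vertices_order_polytope)
  let ?w = "\<chi> a. Poly_Mapping.lookup c (ideal_vertex a)"
  have "Poly_Mapping.lookup c v = Poly_Mapping.lookup (psi ?w) v" for v
  proof (cases "v \<in> range ideal_vertex")
    case True
    then show ?thesis by (auto simp: lookup_psi)
  next
    case False
    then have "v \<notin> Poly_Mapping.keys c" "v \<notin> Poly_Mapping.keys (psi ?w)"
      using keys keys_psi by blast+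
    then show ?thesis by (simp add: in_keys_iff)
  qed
  then have "c = psi ?w"
    by (rule poly_mapping_eqI)
  then show "c \<in> range psi" by blast
qed (use keys_psi in \<open>auto simp: coord_space_def vertices_order_polytope\<close>)

lemma secondary_cone_canonical_triangulation:
  "secondary_cone order_polytope canonical_triangulation = psi ` Collect strict_supermodular"
  by (auto simp: secondary_cone_def coord_space_order_polytope
      regular_subdivision_strict_supermodular strict_supermodular_if_canonical_triangulation)

theorem corollary2p12:
  shows "maximal_secondary_cone
    (order_polytope :: (real ^ 'a::{finite, distrib_lattice}) set)
    (psi ` initial_cone hibi_ideal incomparable_ideal)"
proof -
  let ?Q = "order_polytope :: (real, 'a) vec set"
  let ?D = "Collect strict_supermodular :: (real, 'a) vec set"
  obtain w :: "(real, 'a) vec" where "strict_supermodular w"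
    using strict_supermodular_card_square by blast
  then have "psi ` ?D = secondary_cone ?Q (regular_subdivision ?Q (psi w))"
    by (simp add: regular_subdivision_strict_supermodular secondary_cone_canonical_triangulation)
  then have "psi ` ?D \<in> secondary_fan ?Q"
    unfolding secondary_fan_def coord_space_order_polytope by blast
  moreover have "dim (psi ` ?D) = CARD('a)"
    by (simp add: dim_image_psi dim_strict_supermodular)
  moreover have "card (vertices ?Q) = CARD('a)"
    unfolding vertices_order_polytope by (rule card_image[OF inj_ideal_vertex])
  ultimately show ?thesis
    unfolding maximal_secondary_cone_def initial_cone_hibi_incomparable by simp
qed

end
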